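(* Let $N\in\mathbb{S}^{1,(n+p)(n+m)}$ and $Q\in\mathbb{S}^{n+p,n+m}$ be the data-dependent matrices defined in the context. Let $S\in\mathbb{S}^{m+p}$. Assume that $N|N_{22}>0$ and that $S$ has exactly $p$ negative eigenvalues, no zero eigenvalue and exactly $m$ positive eigenvalues (counted with multiplicity). Partition $$-S^{-1}=\begin{bmatrix}F&G\\ G^\top&H\end{bmatrix},\qquad F\in\mathbb{S}^m,\ H\in\mathbb{S}^p.$$ Then the data $(U_-,X,Y_-)$ are informative for dissipativity with respect to the supply rate $s(u,y)=\begin{bmatrix}u\\ y\end{bmatrix}^\top S\begin{bmatrix}u\\ y\end{bmatrix}$ if and only if there exist an $R\in\mathbb{S}^n$ with $R>0$ and a scalar $\alpha\ge0$ such that $$\begin{bmatrix}R&0&0&0\\ 0&H&0&-G^\top\\ 0&0&-R&0\\ 0&-G&0&F\end{bmatrix}-\alpha Q\ge0.$$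
   Context: Notation. All matrices are real. $\mathbb{S}^n$: symmetric $n\times n$ matrices; $\ge,>,\le,<$ between symmetric matrices refer to (semi)definiteness. $\mathbb{S}^{k,l}$: symmetric $(k+l)\times(k+l)$ matrices partitioned as $\Pi=\begin{bmatrix}\Pi_{11}&\Pi_{12}\\ \Pi_{21}&\Pi_{22}\end{bmatrix}$ with $\Pi_{11}\in\mathbb{S}^k$, $\Pi_{22}\in\mathbb{S}^l$. $Y^\dagger$ is the Moore-Penrose pseudoinverse, $\otimes$ the Kronecker product, $\operatorname{vec}(Y)$ the column-stacking vectorization. $\Pi|\Pi_{22}:=\Pi_{11}-\Pi_{12}\Pi_{22}^{\dagger}\Pi_{21}$, and $\mathbf{\Pi}_{k,l}:=\{\Pi\in\mathbb{S}^{k,l}\mid \Pi_{22}\le 0,\ \ker\Pi_{22}\subseteq\ker\Pi_{12},\ \Pi|\Pi_{22}\ge 0\}$. Data and noise model. Let $n,m,p,T$ be positive integers. The data consist of $U_-=[u(0)\ \cdots\ u(T-1)]\in\mathbb{R}^{m\times T}$, $X=[x(0)\ \cdots\ x(T)]\in\mathbb{R}^{n\times(T+1)}$ and $Y_-=[y(0)\ \cdots\ y(T-1)]\in\mathbb{R}^{p\times T}$; put $X_-=[x(0)\ \cdots\ x(T-1)]$, $X_+=[x(1)\ \cdots\ x(T)]$. Let $\Xi\in\mathbf{\Pi}_{1,(n+p)T}$ be given, with $\Xi_{22}=\xi\otimes I_{n+p}$ for some $\xi\in\mathbb{S}^T$. The set $\Sigma_{(U_-,X,Y_-)}$ of data-compatible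 systems consists of all $(A,B,C,D)\in\mathbb{R}^{n\times n}\times\mathbb{R}^{n\times m}\times\mathbb{R}^{p\times n}\times\mathbb{R}^{p\times m}$ for which $$\begin{bmatrix}X_+\\ Y_-\end{bmatrix}=\begin{bmatrix}A&B\\ C&D\end{bmatrix}\begin{bmatrix}X_-\\ U_-\end{bmatrix}+E_-$$ for some $E_-\in\mathbb{R}^{(n+p)\times T}$ with $\begin{bmatrix}1\\ \operatorname{vec}(E_-)\end{bmatrix}^\top\Xi\begin{bmatrix}1\\ \operatorname{vec}(E_-)\end{bmatrix}\ge0$. The data are generated by a true (unknown) system with noise satisfying this bound, i.e. there is $(A_s,B_s,C_s,D_s)\in\Sigma_{(U_-,X,Y_-)}$. Informativity. Partition $S=\begin{bmatrix}S_{11}&S_{12}\\ S_{21}&S_{22}\end{bmatrix}$ with $S_{11}\in\mathbb{S}^m$, $S_{22}\in\mathbb{S}^p$. The data are informative for dissipativity with respect to the supply rate $s(u,y)$ if there exists $P\in\mathbb{S}^n$ with $P\ge0$ such that $$\begin{bmatrix}I&0\\ 0&I\\ A&B\\ C&D\end{bmatrix}^\top\begin{bmatrix}P&0&0&0\\ 0&S_{11}&0&S_{12}\\ 0&0&-P&0\\ 0&S_{21}&0&S_{22}\end{bmatrix}\begin{bmatrix}I&0\\ 0&I\\ A&B\\ C&D\end{bmatrix}\ge0\quad\text{for all }(A,B,C,D)\in\Sigma_{(U_-,X,Y_-)}.$$ The matrices $N$ and $Q$. Let $$\mathcal{E}:=\begin{bmatrix}1&0\\ \operatorname{vec}\left(\begin{bmatrix}X_+\\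 Y_-\end{bmatrix}\right)&-\begin{bmatrix}X_-\\ U_-\end{bmatrix}^\top\otimes I_{n+p}\end{bmatrix},\qquad N:=\mathcal{E}^\top\Xi\,\mathcal{E}\in\mathbb{S}^{1,(n+p)(n+m)},$$ $$Q_{22}:=\begin{bmatrix}X_-\\ U_-\end{bmatrix}\xi\begin{bmatrix}X_-\\ U_-\end{bmatrix}^\top,\qquad Q:=\begin{bmatrix}(N|N_{22})I_{n+p}+Q_{12}Q_{22}^\dagger Q_{21}&Q_{12}\\ Q_{21}&Q_{22}\end{bmatrix},$$ where $Q_{12}\in\mathbb{R}^{(n+p)\times(n+m)}$ is determined by $\operatorname{vec}(Q_{12})=N_{21}$ and $Q_{21}=Q_{12}^\top$. In the $4\times4$ block inequality of the claim the diagonal blocks have sizes $n,p,n,m$. *)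

theory Defs
  imports "HOL-Analysis.Analysis" "HOL-Computational_Algebra.Polynomial"
begin

text \<open>
  A matrix with \<open>k\<close> rows and \<open>l\<close> columns has type \<open>real^'l^'k\<close>. Block partitions are indexed by
  sum types: \<open>Inl\<close> is the first block of rows (columns), \<open>Inr\<close> the second.
\<close>

definition block_mat ::
  "real^'a^'c \<Rightarrow> real^'b^'c \<Rightarrow> real^'a^'d \<Rightarrow> real^'b^'d \<Rightarrow> real^('a + 'b)^('c + 'd)" where
  "block_mat A B C D = (\<chi> i j. case i of
      Inl i' \<Rightarrow> (case j of Inl j' \<Rightarrow> A $ i' $ j' | Inr j' \<Rightarrow> B $ i' $ j')
    | Inr i' \<Rightarrow> (case j of Inl j' \<Rightarrow> C $ i' $ j' | Inr j' \<Rightarrow> D $ i' $ j'))"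

definition vstack :: "real^'a^'c \<Rightarrow> real^'a^'d \<Rightarrow> real^'a^('c + 'd)" where
  "vstack A B = (\<chi> i j. case i of Inl i' \<Rightarrow> A $ i' $ j | Inr i' \<Rightarrow> B $ i' $ j)"

definition block11 :: "real^('a + 'b::finite)^('c + 'd::finite) \<Rightarrow> real^'a^'c" where
  "block11 M = (\<chi> i j. M $ Inl i $ Inl j)"

definition block12 :: "real^('a::finite + 'b)^('c + 'd::finite) \<Rightarrow> real^'b^'c" where
  "block12 M = (\<chi> i j. M $ Inl i $ Inr j)"

definition block21 :: "real^('a + 'b::finite)^('c::finite + 'd) \<Rightarrow> real^'a^'d" where
  "block21 M = (\<chi> i j. M $ Inr i $ Inl j)"

definition block22 :: "real^('a::finite + 'b)^('c::finite + 'd) \<Rightarrow> real^'b^'d" where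
  "block22 M = (\<chi> i j. M $ Inr i $ Inr j)"

lemma block_mat_blocks [simp]:
  "block11 (block_mat A B C D) = A" "block12 (block_mat A B C D) = B"
  "block21 (block_mat A B C D) = C" "block22 (block_mat A B C D) = D"
  by (simp_all add: block_mat_def block11_def block12_def block21_def block22_def vec_eq_iff)

definition symmetric_mat :: "real^'k^'k \<Rightarrow> bool" where
  "symmetric_mat M \<longleftrightarrow> transpose M = M"

definition psd :: "real^'k^'k \<Rightarrow> bool" where
  "psd M \<longleftrightarrow> symmetric_mat M \<and> (\<forall>v. v \<bullet> (M *v v) \<ge> 0)"

definition pd :: "real^'k^'k \<Rightarrow> bool" where
  "pd M \<longleftrightarrow> symmetric_mat M \<and> (\<forall>v. v \<noteq> 0 \<longrightarrow> v \<bullet> (M *v v) > 0)"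

definition charpoly :: "real^'k^'k \<Rightarrow> real poly" where
  "charpoly M = det (\<chi> i j. (if i = j then [:0, 1:] else 0) - [:M $ i $ j:])"

text \<open>The number of real eigenvalues of \<open>M\<close> in \<open>I\<close>, counted with algebraic multiplicity.\<close>

definition eigenvalue_count :: "real^'k^'k \<Rightarrow> real set \<Rightarrow> nat" where
  "eigenvalue_count M I = (\<Sum>r | r \<in> I \<and> poly (charpoly M) r = 0. order r (charpoly M))"

text \<open>The Moore-Penrose pseudoinverse is the unique solution of the four Penrose equations.\<close>

definition pinv :: "real^'l^'k \<Rightarrow> real^'k^'l" where
  "pinv Y = (THE Z. Y ** Z ** Y = Y \<and> Z ** Y ** Z = Z \<and>
                    transpose (Y ** Z) = Y ** Z \<and> transpose (Z ** Y) = Z ** Y)"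

definition kron :: "real^'b^'a \<Rightarrow> real^'d^'c \<Rightarrow> real^('b \<times> 'd)^('a \<times> 'c)" where
  "kron A B = (\<chi> i j. A $ fst i $ fst j * B $ snd i $ snd j)"

text \<open>
  Column stacking: the position in the stacked vector is the pair (column, row). With the
  lexicographic order this is the usual order, and it is compatible with \<^const>\<open>kron\<close>.
\<close>

definition vectorize :: "real^'l^'k \<Rightarrow> real^('l \<times> 'k)" where
  "vectorize Y = (\<chi> i. Y $ snd i $ fst i)"

definition unvectorize :: "real^('l \<times> 'k) \<Rightarrow> real^'l^'k" where
  "unvectorize v = (\<chi> i j. v $ (j, i))"

lemma vectorize_unvectorize [simp]: "vectorize (unvectorize v) = v"
  by (simp add: vectorize_def unvectorize_def vec_eq_iff)

lemma unvectorize_vectorize [simp]: "unvectorize (vectorize Y) = Y"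
  by (simp add: vectorize_def unvectorize_def vec_eq_iff)

definition schur :: "real^('k + 'l::finite)^('k + 'l) \<Rightarrow> real^'k^'k" where
  "schur M = block11 M - block12 M ** pinv (block22 M) ** block21 M"

definition Pi_set :: "(real^('k::finite + 'l::finite)^('k + 'l)) set" where
  "Pi_set = {M. symmetric_mat M \<and> psd (- block22 M) \<and>
                {v. block22 M *v v = 0} \<subseteq> {v. block12 M *v v = 0} \<and> psd (schur M)}"

text \<open>
  The index type \<open>'t\<close> of length \<open>T = CARD('t)\<close> is linearly ordered; \<open>time\<close> numbers its elements
  \<open>0, \<dots>, T - 1\<close> in increasing order. The signals \<open>u\<close>, \<open>y\<close> are only sampled at \<open>0, \<dots>, T - 1\<close>, and
  \<open>x\<close> at \<open>0, \<dots>, T\<close>.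
\<close>

definition time :: "'t::{finite, linorder} \<Rightarrow> nat" where
  "time t = card {s. s < t}"

lemma strict_mono_time: "strict_mono (time :: 't::{finite, linorder} \<Rightarrow> nat)"
  unfolding time_def by (intro strict_monoI psubset_card_mono) auto

lemma bij_betw_time: "bij_betw time (UNIV :: 't::{finite, linorder} set) {..<CARD('t)}"
proof -
  have inj: "inj (time :: 't \<Rightarrow> nat)"
    using strict_mono_time by (rule strict_mono_imp_inj_on)
  have "time t < CARD('t)" for t :: 't
    unfolding time_def by (intro psubset_card_mono) auto
  then have "range (time :: 't \<Rightarrow> nat) \<subseteq> {..<CARD('t)}"
    by auto
  then have "range (time :: 't \<Rightarrow> nat) = {..<CARD('t)}"
    by (intro card_subset_eq) (simp_all add: card_image inj)
  with inj show ?thesis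
    by (simp add: bij_betw_def)
qed

definition samples :: "(nat \<Rightarrow> real^'k) \<Rightarrow> real^'t::{finite, linorder}^'k" where
  "samples f = (\<chi> i t. f (time t) $ i)"

definition Wminus :: "(nat \<Rightarrow> real^'n) \<Rightarrow> (nat \<Rightarrow> real^'m) \<Rightarrow> real^'t::{finite, linorder}^('n + 'm)" where
  "Wminus x u = vstack (samples x) (samples u)"

definition Wplus :: "(nat \<Rightarrow> real^'n) \<Rightarrow> (nat \<Rightarrow> real^'p) \<Rightarrow> real^'t::{finite, linorder}^('n + 'p)" where
  "Wplus x y = vstack (samples (\<lambda>k. x (Suc k))) (samples y)"

text \<open>The vector \<open>col(1, v)\<close>.\<close>

definition one_cons :: "real^'k \<Rightarrow> real^(1 + 'k)" where
  "one_cons v = (\<chi> i. case i of Inl _ \<Rightarrow> 1 | Inr j \<Rightarrow> v $ j)"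

definition compatible_systems ::
  "real^(1 + 't \<times> ('n + 'p))^(1 + 't::{finite, linorder} \<times> ('n + 'p)) \<Rightarrow>
   (nat \<Rightarrow> real^'m) \<Rightarrow> (nat \<Rightarrow> real^'n) \<Rightarrow> (nat \<Rightarrow> real^'p) \<Rightarrow>
   ((real^'n^'n) \<times> (real^'m^'n) \<times> (real^'n^'p) \<times> (real^'m^'p)) set" where
  "compatible_systems \<Xi> u x y =
    {(A, B, C, D). \<exists>E :: real^'t::{finite, linorder}^('n + 'p).
       Wplus x y = block_mat A B C D ** Wminus x u + E \<and>
       one_cons (vectorize E) \<bullet> (\<Xi> *v one_cons (vectorize E)) \<ge> 0}"

definition dissipation_mat ::
  "real^('m::finite + 'p::finite)^('m + 'p) \<Rightarrow> real^'n^'n \<Rightarrow>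
   real^(('n + 'm) + ('n + 'p))^(('n + 'm) + ('n + 'p))" where
  "dissipation_mat S P =
    block_mat (block_mat P 0 0 (block11 S)) (block_mat 0 0 0 (block12 S))
              (block_mat 0 0 0 (block21 S)) (block_mat (- P) 0 0 (block22 S))"

text \<open>The supply rate is \<open>s(u, y) = col(u, y)\<^sup>T S col(u, y)\<close>.\<close>

definition informative_dissipativity ::
  "real^(1 + 't \<times> ('n + 'p))^(1 + 't::{finite, linorder} \<times> ('n + 'p)) \<Rightarrow>
   (nat \<Rightarrow> real^'m) \<Rightarrow> (nat \<Rightarrow> real^'n) \<Rightarrow> (nat \<Rightarrow> real^'p) \<Rightarrow>
   real^('m + 'p)^('m + 'p) \<Rightarrow> bool" where
  "informative_dissipativity \<Xi> u x y S \<longleftrightarrow>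
    (\<exists>P :: real^'n^'n. psd P \<and>
      (\<forall>(A, B, C, D) \<in> compatible_systems \<Xi> u x y.
         let L = vstack (block_mat (mat 1) 0 0 (mat 1)) (block_mat A B C D)
         in psd (transpose L ** dissipation_mat S P ** L)))"

definition E_mat ::
  "(nat \<Rightarrow> real^'m) \<Rightarrow> (nat \<Rightarrow> real^'n) \<Rightarrow> (nat \<Rightarrow> real^'p) \<Rightarrow>
   real^(1 + ('n + 'm) \<times> ('n + 'p))^(1 + 't::{finite, linorder} \<times> ('n + 'p))" where
  "E_mat u x y =
    block_mat (mat 1) 0
              (columnvector (vectorize (Wplus x y))) (- kron (transpose (Wminus x u)) (mat 1))"

definition N_mat ::
  "real^(1 + 't \<times> ('n + 'p))^(1 + 't::{finite, linorder} \<times> ('n + 'p)) \<Rightarrow>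
   (nat \<Rightarrow> real^'m) \<Rightarrow> (nat \<Rightarrow> real^'n) \<Rightarrow> (nat \<Rightarrow> real^'p) \<Rightarrow>
   real^(1 + ('n + 'm) \<times> ('n + 'p))^(1 + ('n + 'm) \<times> ('n + 'p))" where
  "N_mat \<Xi> u x y = transpose (E_mat u x y) ** \<Xi> ** E_mat u x y"

text \<open>\<open>schur N\<close> is a 1-by-1 matrix; its single entry is the scalar multiplying the identity.\<close>

definition Q_mat ::
  "real^(1 + 't \<times> ('n + 'p))^(1 + 't \<times> ('n + 'p)) \<Rightarrow> real^'t::{finite, linorder}^'t::{finite, linorder} \<Rightarrow>
   (nat \<Rightarrow> real^'m) \<Rightarrow> (nat \<Rightarrow> real^'n) \<Rightarrow> (nat \<Rightarrow> real^'p) \<Rightarrow>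
   real^(('n + 'p) + ('n + 'm))^(('n + 'p) + ('n + 'm))" where
  "Q_mat \<Xi> \<xi> u x y =
    (let N = N_mat \<Xi> u x y;
         Q12 = unvectorize (column 1 (block21 N));
         Q21 = transpose Q12;
         Q22 = Wminus x u ** \<xi> ** transpose (Wminus x u)
     in block_mat ((schur N $ 1 $ 1) *\<^sub>R mat 1 + Q12 ** pinv Q22 ** Q21) Q12 Q21 Q22)"

end

theory Submission
  imports Defs
begin

text \<open>
  Write \<open>M = (A B; C D)\<close>. Completing the square shows that the compatible systems form the Frobenius
  ellipsoid \<open>c + \<langle>M - M0, (M - M0) Q\<^sub>2\<^sub>2\<rangle> \<ge> 0\<close> with \<open>c = N|N\<^sub>2\<^sub>2\<close> and \<open>M0 = - Q\<^sub>1\<^sub>2 Q\<^sub>2\<^sub>2\<^sup>\<dagger>\<close>. Since \<open>c > 0\<close>,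
  the center is an interior point, and the inertia of \<open>S\<close> then forces every admissible storage
  matrix \<open>P\<close> to be positive definite. For such \<open>P\<close> the graph of \<open>M\<close> is a nonnegative subspace of
  maximal dimension of the form of the dissipation inequality, so its orthogonal complement, which is
  parametrized by \<open>M\<^sup>T\<close>, is nonpositive for the inverse form; with \<open>R = P\<^sup>-\<^sup>1\<close> this is the
  form of the claim without the term \<open>\<alpha> Q\<close>. It only sees \<open>M\<close> through single vectors \<open>M\<^sup>T z\<close>,
  and these fill exactly the set where the form of \<open>Q\<close> is nonnegative, so the classical
  S-lemma applies.
\<close>

subsection \<open>Spectral theorem and inertia\<close>

text \<open>Near \<open>t = 0\<close> the linear term dominates; \<open>t = b / k\<close> with
  \<open>k = \<bar>a\<bar> + 1\<close> is close enough to make the left-hand side at least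
  \<open>b\<^sup>2 / k\<close>. This serves as the first-order condition at an extremum of a
  quadratic form.\<close>

lemma quadratic_nonpos_imp_linear_zero:
  fixes b a :: real
  assumes "\<And>t. 2 * t * b + t\<^sup>2 * a \<le> 0"
  shows "b = 0"
proof (rule ccontr)
  assume "b \<noteq> 0"
  define k where "k = \<bar>a\<bar> + 1"
  have k: "k > 0" "a \<ge> - k" by (auto simp: k_def)
  have "2 * (b / k) * b + (b / k)\<^sup>2 * a \<le> 0" by (rule assms)
  moreover have "(b / k)\<^sup>2 * a \<ge> (b / k)\<^sup>2 * (- k)" by (intro mult_left_mono k) auto
  moreover have "(b / k)\<^sup>2 * (- k) = - (b\<^sup>2 / k)" "2 * (b / k) * b = 2 * (b\<^sup>2 / k)"
    using k by (auto simp: power2_eq_square field_simps)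
  ultimately have "b\<^sup>2 / k \<le> 0" by linarith
  with k \<open>b \<noteq> 0\<close> show False by (simp add: divide_le_0_iff not_le)
qed

lemma quadratic_form_add:
  fixes f :: "'a::real_inner \<Rightarrow> 'a"
  assumes "linear f" "\<And>x y. x \<bullet> f y = f x \<bullet> y"
  shows "(x + t *\<^sub>R v) \<bullet> f (x + t *\<^sub>R v) = x \<bullet> f x + 2 * t * (v \<bullet> f x) + t\<^sup>2 * (v \<bullet> f v)"
proof -
  have "x \<bullet> f v = v \<bullet> f x" using assms(2)[of x v] by (simp add: inner_commute)
  then show ?thesis
    by (simp add: linear_add[OF assms(1)] linear_scale[OF assms(1)] inner_simps power2_eq_square algebra_simps)
qed

text \<open>The maximizer of the Rayleigh quotient over the unit sphere of an invariant subspace is an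
  eigenvector.\<close>

lemma selfadjoint_eigenvector:
  fixes f :: "'a::euclidean_space \<Rightarrow> 'a"
  assumes f: "linear f" "\<And>x y. x \<bullet> f y = f x \<bullet> y"
    and V: "subspace V" "f ` V \<subseteq> V" "V \<noteq> {0}"
  obtains e c where "e \<in> V" "norm e = 1" "f e = c *\<^sub>R e"
proof -
  have "compact (sphere 0 1 \<inter> V)"
    by (intro compact_Int_closed compact_sphere closed_subspace V)
  moreover obtain v where v: "v \<in> V" "v \<noteq> 0" using V(1,3) subspace_0 by blast
  then have "(1 / norm v) *\<^sub>R v \<in> sphere 0 1 \<inter> V" using V by (auto simp: subspace_scale)
  then have "sphere 0 1 \<inter> V \<noteq> {}" by blast
  moreover have "continuous_on (sphere 0 1 \<inter> V) (\<lambda>x. x \<bullet> f x)"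
    by (intro continuous_intros linear_continuous_on linear_conv_bounded_linear[THEN iffD1] f)
  ultimately obtain e where e: "e \<in> sphere 0 1 \<inter> V"
    and max: "\<And>x. x \<in> sphere 0 1 \<inter> V \<Longrightarrow> x \<bullet> f x \<le> e \<bullet> f e"
    using continuous_attains_sup by (metis (no_types, lifting))
  define c where "c = e \<bullet> f e"
  have ee: "e \<bullet> e = 1" using e by (simp add: norm_eq_1)
  have le: "x \<bullet> f x \<le> c * (x \<bullet> x)" if "x \<in> V" for x
  proof (cases "x = 0")
    case False
    let ?r = "1 / norm x"
    have "?r *\<^sub>R x \<in> sphere 0 1 \<inter> V" using V False that by (auto simp: subspace_scale)
    from max[OF this] have "?r\<^sup>2 * (x \<bullet> f x) \<le> c"
      by (simp add: c_def linear_scale[OF f(1)] power2_eq_square)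
    then show ?thesis using False
      by (simp add: power2_norm_eq_inner[symmetric] field_simps power_divide)
  qed simp
  \<comment> \<open>The residual \<open>u\<close> lies in \<open>V\<close> and is orthogonal to
    \<open>e\<close>. Maximality at \<open>e\<close> in the direction \<open>u\<close> gives
    \<open>u \<bullet> f e = 0\<close>, and both together give
    \<open>u \<bullet> u = 0\<close>.\<close>
  define u where "u = f e - c *\<^sub>R e"
  have uV: "u \<in> V" unfolding u_def using e V by (auto intro!: subspace_diff subspace_scale)
  have ue: "u \<bullet> e = 0" by (simp add: u_def inner_simps ee c_def inner_commute)
  have "u \<bullet> f e = 0"
  proof (rule quadratic_nonpos_imp_linear_zero)
    fix t
    have "e + t *\<^sub>R u \<in> V" using e uV V by (auto intro!: subspace_add subspace_scale)
    note le[OF this]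
    moreover have "(e + t *\<^sub>R u) \<bullet> (e + t *\<^sub>R u) = 1 + t\<^sup>2 * (u \<bullet> u)"
      using ue ee by (simp add: inner_simps inner_commute power2_eq_square)
    ultimately have "e \<bullet> f e + 2 * t * (u \<bullet> f e) + t\<^sup>2 * (u \<bullet> f u) \<le> c * (1 + t\<^sup>2 * (u \<bullet> u))"
      by (simp only: quadratic_form_add[OF f])
    then show "2 * t * (u \<bullet> f e) + t\<^sup>2 * (u \<bullet> f u - c * (u \<bullet> u)) \<le> 0"
      by (simp add: c_def[symmetric] algebra_simps)
  qed
  then have "u \<bullet> u = 0" using ue by (simp add: u_def inner_simps)
  then have "f e = c *\<^sub>R e" by (simp add: u_def)
  with e show thesis by (intro that) auto
qed

text \<open>Induction on the dimension: self-adjointness makes the orthogonal complement of an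
  eigenvector within \<open>V\<close> invariant again. Invariant subspaces, rather than the whole
  space, let the induction hypothesis apply to it.\<close>

lemma selfadjoint_eigenbasis:
  fixes f :: "'a::euclidean_space \<Rightarrow> 'a"
  assumes f: "linear f" "\<And>x y. x \<bullet> f y = f x \<bullet> y"
    and V: "subspace V" "f ` V \<subseteq> V"
  shows "\<exists>B. pairwise orthogonal B \<and> (\<forall>b\<in>B. norm b = 1 \<and> (\<exists>c. f b = c *\<^sub>R b)) \<and> span B = V"
  using V
proof (induction "dim V" arbitrary: V rule: less_induct)
  case less
  show ?case
  proof (cases "V = {0}")
    case True
    then show ?thesis by (intro exI[of _ "{}"]) auto
  next
    case False
    obtain e c where e: "e \<in> V" "norm e = 1" "f e = c *\<^sub>R e"
      using selfadjoint_eigenvector[OF f less.prems False] by metis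
    have ee: "e \<bullet> e = 1" using e by (simp add: norm_eq_1)
    define W where "W = V \<inter> {x. e \<bullet> x = 0}"
    have W: "subspace W" unfolding W_def by (intro subspace_inter less.prems subspace_hyperplane)
    have "e \<bullet> f x = 0" if "e \<bullet> x = 0" for x using f(2)[of e x] e(3) that by simp
    then have fW: "f ` W \<subseteq> W" using less.prems by (auto simp: W_def)
    have "e \<notin> W" "W \<subseteq> V" using ee by (auto simp: W_def)
    with e have "dim W < dim V" using W less.prems
      by (metis subspace_dim_equal dim_subset le_neq_implies_less dual_order.refl)
    from less.hyps[OF this W fW] obtain B where
      B: "pairwise orthogonal B" "\<forall>b\<in>B. norm b = 1 \<and> (\<exists>c. f b = c *\<^sub>R b)" "span B = W" by blast
    have BW: "B \<subseteq> W" using B(3) span_superset by blast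
    have "pairwise orthogonal (insert e B)"
      using B(1) BW by (auto simp: pairwise_insert W_def orthogonal_def inner_commute)
    moreover have "span (insert e B) = V"
    proof
      show "span (insert e B) \<subseteq> V" using e BW \<open>W \<subseteq> V\<close> less.prems by (intro span_minimal) auto
      show "V \<subseteq> span (insert e B)"
      proof
        fix x assume "x \<in> V"
        then have "x - (e \<bullet> x) *\<^sub>R e \<in> span B" unfolding B(3) W_def using e less.prems ee
          by (auto intro!: subspace_diff subspace_scale simp: inner_simps)
        then show "x \<in> span (insert e B)" by (auto simp: span_insert)
      qed
    qed
    ultimately show ?thesis using B(2) e by (intro exI[of _ "insert e B"]) auto
  qed
qed

section \<open>Spectral decomposition of symmetric matrices\<close>

lemma symmetric_mat_inner:
  fixes M :: "real^'k^'k"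
  assumes "symmetric_mat M"
  shows "x \<bullet> (M *v y) = (M *v x) \<bullet> y"
  using assms dot_lmul_matrix[of x M y] by (metis symmetric_mat_def transpose_matrix_vector)

lemma symmetric_matI:
  fixes M :: "real^'k^'k"
  assumes "\<And>x y. x \<bullet> (M *v y) = (M *v x) \<bullet> y"
  shows "symmetric_mat M"
proof -
  have "(transpose M *v x) \<bullet> y = (M *v x) \<bullet> y" for x y
    using assms[of x y] by (simp add: dot_lmul_matrix)
  then have "transpose M *v x = M *v x" for x by (metis vector_eq_rdot)
  then show ?thesis unfolding symmetric_mat_def by (simp only: matrix_eq simp_thms)
qed

definition diag_mat :: "('k \<Rightarrow> real) \<Rightarrow> real^'k^'k" where
  "diag_mat d = (\<chi> i j. if i = j then d i else 0)"

lemma transpose_diag_mat [simp]: "transpose (diag_mat d) = diag_mat d"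
  by (auto simp: diag_mat_def transpose_def vec_eq_iff)

lemma diag_mat_mult: "diag_mat c ** diag_mat d = diag_mat (\<lambda>i. c i * d i)"
proof -
  have "(if i = k then c i else 0) * (if k = j then d k else 0) =
      (if k = i then (if i = j then c i * d i else 0) else 0)" for i j k :: 'a
    by auto
  then show ?thesis by (simp add: diag_mat_def matrix_matrix_mult_def vec_eq_iff)
qed

lemma det_diag_mat: "det (diag_mat d) = (\<Prod>i\<in>UNIV. d i)"
  by (subst det_diagonal) (auto simp: diag_mat_def)

lemma diag_mat_vec: "(diag_mat d *v v) $ i = d i * v $ i"
  by (simp add: diag_mat_def matrix_vector_mult_def if_distrib if_distribR cong: if_cong)

text \<open>An orthonormal eigenbasis has \<open>CARD('k)\<close> elements, so the index type itself
  can number it; the basis vectors become the columns of \<open>U\<close>, and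
  \<open>M ** U = U ** diag_mat d\<close>.\<close>

theorem spectral_decomposition:
  fixes M :: "real^'k^'k"
  assumes "symmetric_mat M"
  obtains U d where "orthogonal_matrix U" "M = U ** diag_mat d ** transpose U"
proof -
  obtain B where B: "pairwise orthogonal B" "\<forall>b\<in>B. norm b = 1 \<and> (\<exists>c. M *v b = c *\<^sub>R b)"
      "span B = (UNIV :: (real^'k) set)"
    using selfadjoint_eigenbasis[of "\<lambda>x. M *v x" UNIV] symmetric_mat_inner[OF assms]
    by (auto simp: matrix_vector_mul_linear)
  have "independent B" using B(1,2) by (intro pairwise_orthogonal_independent) auto
  then have "card B = CARD('k)" "finite B"
    using B(3) dim_eq_card[of B UNIV] finiteI_independent by auto
  then obtain e where e: "bij_betw e (UNIV :: 'k set) B"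
    using finite_same_card_bij by (metis finite)
  then have eB: "e i \<in> B" for i by (auto simp: bij_betw_def)
  then have "\<exists>d. \<forall>i. M *v e i = d i *\<^sub>R e i" using B(2) by (intro choice) blast
  then obtain d where d: "\<And>i. M *v e i = d i *\<^sub>R e i" by blast
  have on: "e i \<bullet> e j = (if i = j then 1 else 0)" for i j
  proof (cases "i = j")
    case True then show ?thesis using B(2) eB by (simp add: norm_eq_1)
  next
    case False
    then have "e i \<noteq> e j" using e by (auto simp: bij_betw_def inj_on_def)
    then show ?thesis using B(1) eB False by (auto simp: pairwise_def orthogonal_def)
  qed
  define U :: "real^'k^'k" where "U = (\<chi> i j. e j $ i)"
  have "transpose U ** U = mat 1"
    using on by (simp add: U_def vec_eq_iff matrix_matrix_mult_def transpose_def mat_def inner_vec_def)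
  then have U: "orthogonal_matrix U" by (simp add: orthogonal_matrix)
  have "(M ** U) $ i $ j = (U ** diag_mat d) $ i $ j" for i j
  proof -
    have "(M ** U) $ i $ j = (M *v e j) $ i"
      by (simp add: U_def matrix_matrix_mult_def matrix_vector_mult_def)
    moreover have "(U ** diag_mat d) $ i $ j = d j * e j $ i"
      by (simp add: U_def matrix_matrix_mult_def diag_mat_def if_distrib if_distribR cong: if_cong)
    ultimately show ?thesis by (simp add: d)
  qed
  then have "M ** U = U ** diag_mat d" by (simp add: vec_eq_iff)
  then have "M ** (U ** transpose U) = U ** diag_mat d ** transpose U"
    by (simp add: matrix_mul_assoc)
  with U show thesis by (intro that) (auto simp: orthogonal_matrix_def)
qed

lemma matrix_diff_ldistrib: "A ** (B - C) = A ** B - A ** (C :: real^'l^'m)"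
  and matrix_diff_rdistrib: "(B' - C') ** D = B' ** D - C' ** (D :: real^'l^'m)"
  by (simp_all add: matrix_matrix_mult_def vec_eq_iff sum_subtractf algebra_simps)

section \<open>Characteristic polynomial and inertia\<close>

lemma poly_charpoly: "poly (charpoly M) r = det (r *\<^sub>R mat 1 - M)"
  unfolding charpoly_def det_def
  by (auto simp: poly_sum poly_prod mat_def intro!: sum.cong prod.cong)

text \<open>Polynomials over the reals are equal once they agree as functions, and at each
  \<open>r\<close> the orthogonal conjugation drops out of the determinant.\<close>

lemma charpoly_spectral:
  fixes U :: "real^'k^'k"
  assumes U: "orthogonal_matrix U"
  shows "charpoly (U ** diag_mat d ** transpose U) = (\<Prod>i\<in>UNIV. [:- d i, 1:])"
proof (rule poly_eq_poly_eq_iff[THEN iffD1], rule ext)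
  fix r
  have "r *\<^sub>R mat 1 = r *\<^sub>R (U ** transpose U)" using U by (simp add: orthogonal_matrix_def)
  also have "\<dots> = U ** (r *\<^sub>R mat 1) ** transpose U"
    by (simp add: scalar_matrix_assoc[symmetric] matrix_scalar_ac)
  finally have "r *\<^sub>R mat 1 - U ** diag_mat d ** transpose U =
      U ** (r *\<^sub>R mat 1 - diag_mat d) ** transpose U"
    by (simp only: matrix_diff_ldistrib matrix_diff_rdistrib)
  also have "r *\<^sub>R mat 1 - diag_mat d = diag_mat (\<lambda>i. r - d i)"
    by (auto simp: diag_mat_def mat_def vec_eq_iff)
  finally have "poly (charpoly (U ** diag_mat d ** transpose U)) r =
      det U * (\<Prod>i\<in>UNIV. r - d i) * det U"
    by (simp add: poly_charpoly det_mul det_diag_mat)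
  moreover have "det U * det U = 1"
    using U by (metis det_I det_mul det_transpose orthogonal_matrix_def)
  ultimately show "poly (charpoly (U ** diag_mat d ** transpose U)) r = poly (\<Prod>i\<in>UNIV. [:- d i, 1:]) r"
    by (simp add: poly_prod mult.commute mult.left_commute)
qed

lemma order_prod_linear:
  fixes d :: "'k \<Rightarrow> real"
  assumes "finite A"
  shows "order r (\<Prod>i\<in>A. [:- d i, 1:]) = card {i \<in> A. d i = r}"
  using assms
proof (induction A rule: finite_induct)
  case empty
  then show ?case by simp
next
  case (insert a A)
  have "[:- d a, 1:] * (\<Prod>i\<in>A. [:- d i, 1:]) \<noteq> 0" using insert(1) by (simp add: prod_zero_iff del: mult_pCons_left)
  moreover have "order r [:- d a, 1:] = (if d a = r then 1 else 0)"
    using order_power_n_n[of "d a" 1] by (auto intro: order_0I)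
  moreover have "{i \<in> insert a A. d i = r} =
      (if d a = r then insert a {i \<in> A. d i = r} else {i \<in> A. d i = r})" by auto
  ultimately show ?case using insert(1,2,3)
    by (simp only: prod.insert order_mult not_False_eq_True if_True if_False) simp
qed

text \<open>The multiplicity of a root is the size of its fiber under \<open>d\<close>, and the
  fibers over distinct roots are disjoint. This reduces inertia to counting diagonal
  entries.\<close>

lemma eigenvalue_count_spectral:
  fixes U :: "real^'k^'k"
  assumes U: "orthogonal_matrix U"
  shows "eigenvalue_count (U ** diag_mat d ** transpose U) I = card {i. d i \<in> I}"
proof -
  have "{r. r \<in> I \<and> poly (\<Prod>i\<in>UNIV. [:- d i, 1:]) r = 0} = d ` {i. d i \<in> I}"
    by (auto simp: poly_prod)
  then have "eigenvalue_count (U ** diag_mat d ** transpose U) I =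
      (\<Sum>r\<in>d ` {i. d i \<in> I}. card {i. d i = r})"
    unfolding eigenvalue_count_def charpoly_spectral[OF U] by (simp add: order_prod_linear)
  also have "\<dots> = card (\<Union>r\<in>d ` {i. d i \<in> I}. {i. d i = r})"
    by (rule card_UN_disjoint[symmetric]) auto
  also have "(\<Union>r\<in>d ` {i. d i \<in> I}. {i. d i = r}) = {i. d i \<in> I}" by auto
  finally show ?thesis .
qed

lemma orthogonal_matrix_transpose_mult:
  "orthogonal_matrix U \<Longrightarrow> transpose U ** U = mat 1" "orthogonal_matrix U \<Longrightarrow> U ** transpose U = mat 1"
  by (auto simp: orthogonal_matrix_def)

text \<open>The eigenvectors with \<open>s * d i > 0\<close> span the subspace; on it the form is a
  sum of squares with coefficients of one sign. Taking \<open>s\<close> to be \<open>1\<close> or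
  \<open>- 1\<close> covers the positive and the negative case.\<close>

lemma definite_subspace:
  fixes M :: "real^'k^'k"
  assumes "symmetric_mat M"
  obtains V where "subspace V" "dim V = eigenvalue_count M {r. s * r > 0}"
    "\<And>v. v \<in> V \<Longrightarrow> v \<noteq> 0 \<Longrightarrow> s * (v \<bullet> (M *v v)) > 0"
proof -
  obtain U d where U: "orthogonal_matrix U" and M: "M = U ** diag_mat d ** transpose U"
    using spectral_decomposition[OF assms] by blast
  define J where "J = {i. s * d i > 0}"
  define T where "T = {w :: real^'k. \<forall>i. i \<notin> J \<longrightarrow> w $ i = 0}"
  have T: "subspace T" by (auto simp: T_def subspace_def)
  have UU: "transpose U *v (U *v w) = w" for w
    using U by (simp add: matrix_vector_mul_assoc orthogonal_matrix_transpose_mult del: transpose_matrix_vector)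
  then have inj: "inj ((*v) U)" by (metis injI)
  have "T = span ((\<lambda>i. axis i 1) ` J)" (is "_ = span ?B")
  proof
    have "axis i 1 $ j = 0" if "i \<in> J" "j \<notin> J" for i j :: 'k using that by (auto simp: axis_def)
    then show "span ?B \<subseteq> T" by (intro span_minimal T) (auto simp: T_def)
    show "T \<subseteq> span ?B"
    proof
      fix w assume "w \<in> T"
      have "w = (\<Sum>i\<in>UNIV. w $ i *\<^sub>R axis i 1)" 
        by (simp add: vec_eq_iff axis_def if_distrib cong: if_cong)
      also have "\<dots> = (\<Sum>i\<in>J. w $ i *\<^sub>R axis i 1)"
        using \<open>w \<in> T\<close> by (intro sum.mono_neutral_right) (auto simp: T_def)
      also have "\<dots> \<in> span ?B" by (intro span_sum span_scale span_base) auto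
      finally show "w \<in> span ?B" .
    qed
  qed
  moreover have "independent ?B"
    by (rule independent_mono[OF independent_Basis]) (auto simp: Basis_vec_def)
  moreover have "card ?B = card J" by (intro card_image) (auto simp: inj_on_def axis_eq_axis)
  ultimately have dT: "dim T = card J" by (simp add: dim_eq_card_independent)
  show thesis
  proof
    show "subspace ((*v) U ` T)" by (intro linear_subspace_image T matrix_vector_mul_linear)
    show "dim ((*v) U ` T) = eigenvalue_count M {r. s * r > 0}"
      unfolding M eigenvalue_count_spectral[OF U]
      using dim_image_eq[OF matrix_vector_mul_linear, of U T] inj dT
      by (simp add: J_def inj_on_subset)
    fix v assume "v \<in> (*v) U ` T" "v \<noteq> 0"
    then obtain w where w: "w \<in> T" "v = U *v w" by blast
    with \<open>v \<noteq> 0\<close> have "w \<noteq> 0" by auto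
    have "v \<bullet> (M *v v) = w \<bullet> (transpose U *v (U *v (diag_mat d *v (transpose U *v (U *v w)))))"
      unfolding M w by (metis dot_lmul_matrix matrix_vector_mul_assoc vector_transpose_matrix)
    also have "\<dots> = w \<bullet> (diag_mat d *v w)" by (simp only: UU)
    also have "\<dots> = (\<Sum>i\<in>UNIV. d i * (w $ i)\<^sup>2)"
      by (simp add: inner_vec_def diag_mat_vec power2_eq_square algebra_simps)
    finally have "s * (v \<bullet> (M *v v)) = (\<Sum>i\<in>UNIV. s * d i * (w $ i)\<^sup>2)"
      by (simp add: sum_distrib_left mult.assoc)
    moreover obtain k where k: "w $ k \<noteq> 0" using \<open>w \<noteq> 0\<close> by (auto simp: vec_eq_iff)
    then have "k \<in> J" using w(1) by (auto simp: T_def)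
    then have "0 < s * d k * (w $ k)\<^sup>2" using k by (simp add: J_def)
    moreover have "0 \<le> s * d i * (w $ i)\<^sup>2" for i
      using w(1) by (cases "i \<in> J") (auto simp: T_def J_def)
    ultimately show "0 < s * (v \<bullet> (M *v v))" by (simp add: sum_pos2[of _ k])
  qed
qed

lemma invertible_if_eigenvalue_count_0:
  fixes M :: "real^'k^'k"
  assumes "symmetric_mat M" "eigenvalue_count M {0} = 0"
  shows "invertible M"
proof -
  obtain U d where U: "orthogonal_matrix U" and M: "M = U ** diag_mat d ** transpose U"
    using spectral_decomposition[OF assms(1)] by blast
  have "d i \<noteq> 0" for i using assms(2) unfolding M eigenvalue_count_spectral[OF U] by auto
  moreover have "det U \<noteq> 0"
    using U by (metis det_I det_mul orthogonal_matrix_def zero_neq_one mult_eq_0_iff)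
  ultimately show ?thesis by (simp add: M invertible_det_nz det_mul det_diag_mat)
qed

subsection \<open>Pseudoinverse, Kronecker product and vectorization\<close>

text \<open>The relation inside the description in \<open>pinv\<close>, separated so that uniqueness
  and existence can be proved on their own.\<close>

definition penrose :: "real^'l^'k \<Rightarrow> real^'k^'l \<Rightarrow> bool" where
  "penrose Y Z \<longleftrightarrow> Y ** Z ** Y = Y \<and> Z ** Y ** Z = Z \<and>
     transpose (Y ** Z) = Y ** Z \<and> transpose (Z ** Y) = Z ** Y"

text \<open>\<open>Y ** Z\<close> and \<open>Y ** Z'\<close> are both the orthogonal projection onto
  the range of \<open>Y\<close>, hence equal; likewise \<open>Z ** Y\<close> and
  \<open>Z' ** Y\<close>. These products determine \<open>Z = Z ** Y ** Z\<close>.\<close>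

lemma penrose_unique:
  assumes "penrose Y Z" "penrose Y Z'"
  shows "Z = Z'"
proof -
  note A = assms(1)[unfolded penrose_def] and B = assms(2)[unfolded penrose_def]
  have "Y ** Z = (Y ** Z') ** (Y ** Z)" using B by (simp add: matrix_mul_assoc)
  also have "\<dots> = transpose ((Y ** Z) ** (Y ** Z'))" using A B by (simp add: matrix_transpose_mul)
  also have "(Y ** Z) ** (Y ** Z') = Y ** Z'" using A by (simp add: matrix_mul_assoc)
  finally have 1: "Y ** Z = Y ** Z'" using B by simp
  have "Z ** Y = (Z ** Y) ** (Z' ** Y)" using B by (metis matrix_mul_assoc)
  also have "\<dots> = transpose ((Z' ** Y) ** (Z ** Y))" using A B by (simp add: matrix_transpose_mul)
  also have "(Z' ** Y) ** (Z ** Y) = Z' ** Y" using A by (metis matrix_mul_assoc)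
  finally have 2: "Z ** Y = Z' ** Y" using B by simp
  have "Z = Z ** (Y ** Z)" using A by (simp add: matrix_mul_assoc)
  also have "\<dots> = Z' ** Y ** Z'" using 1 2 by (simp add: matrix_mul_assoc)
  finally show ?thesis using B by simp
qed

lemma pinv_eqI: "penrose Y Z \<Longrightarrow> pinv Y = Z"
  unfolding pinv_def using penrose_unique unfolding penrose_def by (intro the_equality) blast+

lemma penrose_pinv_symmetric:
  fixes M :: "real^'k^'k"
  assumes "symmetric_mat M"
  shows "penrose M (pinv M)" and "symmetric_mat (pinv M)"
proof -
  obtain U d where U: "orthogonal_matrix U" and M: "M = U ** diag_mat d ** transpose U"
    using spectral_decomposition[OF assms] by blast
  \<comment> \<open>The convention \<open>inverse 0 = 0\<close> makes this invert the nonzero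
    eigenvalues and keep the zero ones, as the Penrose equations demand.\<close>
  define Z where "Z = U ** diag_mat (\<lambda>i. inverse (d i)) ** transpose U"
  have mult: "(U ** diag_mat a ** transpose U) ** (U ** diag_mat b ** transpose U) =
      U ** diag_mat (\<lambda>i. a i * b i) ** transpose U" for a b
  proof -
    have "(U ** diag_mat a ** transpose U) ** (U ** diag_mat b ** transpose U) =
        U ** diag_mat a ** (transpose U ** U) ** diag_mat b ** transpose U"
      by (simp add: matrix_mul_assoc)
    then show ?thesis
      by (simp add: orthogonal_matrix_transpose_mult[OF U] matrix_mul_assoc[symmetric] diag_mat_mult)
  qed
  have sym: "transpose (U ** diag_mat a ** transpose U) = U ** diag_mat a ** transpose U" for a
    by (simp add: matrix_transpose_mul matrix_mul_assoc)
  have inv: "a * inverse a * a = a" "inverse a * a * inverse a = inverse a" for a :: real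
    by (cases "a = 0"; simp)+
  then have P: "penrose M Z" unfolding penrose_def M Z_def mult sym by (simp only: inv simp_thms)
  then show "penrose M (pinv M)" by (simp add: pinv_eqI)
  show "symmetric_mat (pinv M)" unfolding pinv_eqI[OF P] symmetric_mat_def Z_def by (rule sym)
qed

lemma kron_mat1_mult: "kron A (mat 1) ** kron B (mat 1) = kron (A ** B) (mat 1 :: real^'k^'k)"
proof -
  have "(\<Sum>k\<in>UNIV. kron A (mat 1) $ i $ k * kron B (mat 1) $ k $ j) =
      kron (A ** B) (mat 1 :: real^'k^'k) $ i $ j" for i j
  proof -
    have "(\<Sum>k\<in>UNIV. kron A (mat 1 :: real^'k^'k) $ i $ k * kron B (mat 1 :: real^'k^'k) $ k $ j) =
        (\<Sum>a\<in>UNIV. \<Sum>c\<in>UNIV. A $ fst i $ a * (if snd i = c then 1 else 0) *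
           (B $ a $ fst j * (if c = snd j then 1 else 0)))"
      by (simp add: kron_def mat_def sum.cartesian_product UNIV_Times_UNIV[symmetric] case_prod_unfold
            del: UNIV_Times_UNIV)
    also have "\<dots> = (\<Sum>a\<in>UNIV. \<Sum>c\<in>UNIV. if c = snd i then
        A $ fst i $ a * B $ a $ fst j * (if snd i = snd j then 1 else 0) else 0)"
      by (intro sum.cong) auto
    finally show ?thesis by (simp add: kron_def mat_def matrix_matrix_mult_def)
  qed
  then show ?thesis unfolding matrix_matrix_mult_def[of "kron A (mat 1)"] by (simp add: vec_eq_iff)
qed

lemma transpose_kron_mat1: "transpose (kron A (mat 1)) = kron (transpose A) (mat 1)"
  by (auto simp: transpose_def kron_def mat_def vec_eq_iff)

text \<open>The map \<open>\<lambda>A. kron A (mat 1)\<close> respects products and transposes, so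
  it carries over all four Penrose equations.\<close>

lemma pinv_kron_mat1:
  assumes "penrose Y Z"
  shows "pinv (kron Y (mat 1)) = kron Z (mat 1)"
  using assms by (intro pinv_eqI) (simp add: penrose_def kron_mat1_mult transpose_kron_mat1)

text \<open>Lets the Kronecker matrices act as right multiplication on the unknown matrix, so that
  everything later can be phrased without stacking.\<close>

lemma kron_mat1_vectorize: "kron A (mat 1) *v vectorize M = vectorize (M ** transpose A)"
proof -
  have "(\<Sum>k\<in>UNIV. kron A (mat 1) $ i $ k * vectorize M $ k) = vectorize (M ** transpose A) $ i" for i
  proof -
    have "(\<Sum>k\<in>UNIV. kron A (mat 1) $ i $ k * vectorize M $ k) =
        (\<Sum>a\<in>UNIV. \<Sum>c\<in>UNIV. A $ fst i $ a * (if snd i = c then 1 else 0) * M $ c $ a)"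
      by (simp add: kron_def mat_def vectorize_def sum.cartesian_product UNIV_Times_UNIV[symmetric]
            case_prod_unfold del: UNIV_Times_UNIV)
    also have "\<dots> = (\<Sum>a\<in>UNIV. \<Sum>c\<in>UNIV. if c = snd i then M $ snd i $ a * A $ fst i $ a else 0)"
      by (intro sum.cong) auto
    finally show ?thesis by (simp add: vectorize_def matrix_matrix_mult_def transpose_def)
  qed
  then show ?thesis unfolding matrix_vector_mult_def[of "kron A (mat 1)"] by (simp add: vec_eq_iff)
qed

lemma inner_vectorize: "vectorize M \<bullet> vectorize N = M \<bullet> N"
proof -
  have "vectorize M \<bullet> vectorize N = (\<Sum>a\<in>UNIV. \<Sum>c\<in>UNIV. M $ c $ a * N $ c $ a)"
    by (simp add: inner_vec_def vectorize_def sum.cartesian_product UNIV_Times_UNIV[symmetric]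
          case_prod_unfold del: UNIV_Times_UNIV)
  also have "\<dots> = M \<bullet> N" by (subst sum.swap) (simp add: inner_vec_def)
  finally show ?thesis .
qed

subsection \<open>The S-lemma\<close>

text \<open>The roots have product \<open>c / a < 0\<close>, so one of them is positive; with
  \<open>s \<ge> \<bar>b\<bar>\<close> and \<open>a < 0\<close> it is
  \<open>(- b - s) / a\<close>.\<close>

lemma quadratic_root_nonneg:
  fixes a b c :: real
  assumes "a < 0" "c > 0"
  shows "\<exists>t\<ge>0. c + 2 * t * b + t\<^sup>2 * a = 0"
proof -
  define s where "s = sqrt (b\<^sup>2 - a * c)"
  have ac: "a * c < 0" using assms by (simp add: mult_neg_pos)
  then have s2: "s\<^sup>2 = b\<^sup>2 - a * c" unfolding s_def
    using zero_le_power2[of b] by (intro real_sqrt_pow2) linarith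
  have "\<bar>b\<bar> \<le> s" unfolding s_def
    using ac by (intro real_le_rsqrt) simp
  then have "(- b - s) / a \<ge> 0" using assms by (intro divide_nonpos_neg) auto
  moreover have "c + 2 * ((- b - s) / a) * b + ((- b - s) / a)\<^sup>2 * a = 0" (is "?q ((- b - s) / a) = 0")
  proof -
    have "a * ?q t = (a * t + b)\<^sup>2 - b\<^sup>2 + a * c" for t by (simp add: power2_eq_square algebra_simps)
    from this[of "(- b - s) / a"] have "a * ?q ((- b - s) / a) = 0" using assms s2 by simp
    then show ?thesis using assms by simp
  qed
  ultimately show ?thesis by blast
qed

text \<open>The multiplier is the infimum of \<open>g/f\<close> over \<open>f > 0\<close>. That it dominates \<open>g/f\<close> where \<open>f < 0\<close> is
  a two-dimensional matter: otherwise some \<open>g - \<beta> f\<close> is negative at two points where \<open>f\<close> has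
  opposite signs, hence also at a zero of \<open>f\<close> on a line through them.\<close>

theorem s_lemma:
  fixes f g :: "'a::real_inner \<Rightarrow> 'a"
  assumes f: "linear f" "\<And>x y. x \<bullet> f y = f x \<bullet> y" and g: "linear g" "\<And>x y. x \<bullet> g y = g x \<bullet> y"
    and slater: "x0 \<bullet> f x0 > 0"
    and imp: "\<And>x. x \<bullet> f x \<ge> 0 \<Longrightarrow> x \<bullet> g x \<ge> 0"
  shows "\<exists>\<alpha>\<ge>0. \<forall>x. x \<bullet> g x \<ge> \<alpha> * (x \<bullet> f x)"
proof -
  have key: "y \<bullet> g y / (y \<bullet> f y) \<ge> x \<bullet> g x / (x \<bullet> f x)" if y: "y \<bullet> f y > 0" and x0: "x \<bullet> f x < 0" for x y
  proof (rule ccontr)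
    assume "\<not> ?thesis"
    then obtain \<beta> where \<beta>: "y \<bullet> g y / (y \<bullet> f y) < \<beta>" "\<beta> < x \<bullet> g x / (x \<bullet> f x)"
      using dense by (meson not_le)
    define h where "h z = g z - \<beta> *\<^sub>R f z" for z
    have h: "linear h" "\<And>x y. x \<bullet> h y = h x \<bullet> y"
      unfolding h_def using f g by (auto intro!: linear_compose_sub linear_compose_scale_right simp: inner_simps)
    have hq: "z \<bullet> h z = z \<bullet> g z - \<beta> * (z \<bullet> f z)" for z by (simp add: h_def inner_simps)
    have hy: "y \<bullet> h y < 0" using \<beta>(1) y by (simp add: hq divide_less_eq)
    have hx: "x \<bullet> h x < 0" using \<beta>(2) x0 by (simp add: hq less_divide_eq)
    \<comment> \<open>Replacing \<open>x\<close> by \<open>- x\<close> changes neither form at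
      \<open>x\<close>, so the sign can be chosen to make the mixed term of \<open>h\<close>
      nonpositive.\<close>
    define e where "e = (if x \<bullet> h y > 0 then - 1 else 1 :: real)"
    define w where "w = e *\<^sub>R x"
    have e2: "e * e = 1" by (simp add: e_def)
    have w: "w \<bullet> f w = x \<bullet> f x" "w \<bullet> h w = x \<bullet> h x" "w \<bullet> h y \<le> 0"
      using e2 by (auto simp: w_def linear_scale[OF f(1)] linear_scale[OF h(1)] mult.assoc[symmetric])
        (auto simp: e_def)
    \<comment> \<open>At this zero of \<open>f\<close> the forms of \<open>h\<close> and
      \<open>g\<close> coincide, so \<open>h\<close> is nonnegative there; but all three terms of
      its expansion are nonpositive and the first is negative.\<close>
    obtain t where t: "t \<ge> 0" "y \<bullet> f y + 2 * t * (w \<bullet> f y) + t\<^sup>2 * (w \<bullet> f w) = 0"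
      using quadratic_root_nonneg[of "w \<bullet> f w" "y \<bullet> f y" "w \<bullet> f y"] x0 y w by auto
    let ?z = "y + t *\<^sub>R w"
    have "?z \<bullet> f ?z = 0" using t by (simp only: quadratic_form_add[OF f])
    with imp[of ?z] have "?z \<bullet> h ?z \<ge> 0" by (simp add: hq)
    moreover have "?z \<bullet> h ?z = y \<bullet> h y + 2 * (t * (w \<bullet> h y)) + t\<^sup>2 * (w \<bullet> h w)"
      by (simp add: quadratic_form_add[OF h])
    moreover have "t * (w \<bullet> h y) \<le> 0" "t\<^sup>2 * (w \<bullet> h w) \<le> 0"
      using t w hx by (auto intro!: mult_nonneg_nonpos)
    ultimately show False using hy by linarith
  qed
  define A where "A = {y \<bullet> g y / (y \<bullet> f y) | y. y \<bullet> f y > 0}"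
  define \<alpha> where "\<alpha> = Inf A"
  have ne: "A \<noteq> {}" using slater by (auto simp: A_def)
  have A0: "a \<ge> 0" if "a \<in> A" for a using that imp by (auto simp: A_def)
  then have bdd: "bdd_below A" by (auto simp: bdd_below_def)
  have "x \<bullet> g x \<ge> \<alpha> * (x \<bullet> f x)" for x
  proof (cases "x \<bullet> f x" "0 :: real" rule: linorder_cases)
    case less
    have "x \<bullet> g x / (x \<bullet> f x) \<le> \<alpha>" unfolding \<alpha>_def
      using key less by (intro cInf_greatest ne) (auto simp: A_def)
    with less show ?thesis by (simp add: divide_le_eq)
  next
    case equal
    then show ?thesis using imp[of x] by simp
  next
    case greater
    then have "\<alpha> \<le> x \<bullet> g x / (x \<bullet> f x)" unfolding \<alpha>_def
      by (intro cInf_lower bdd) (auto simp: A_def)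
    with greater show ?thesis by (simp add: le_divide_eq)
  qed
  moreover have "\<alpha> \<ge> 0" unfolding \<alpha>_def using A0 by (intro cInf_greatest ne)
  ultimately show ?thesis by blast
qed

subsection \<open>Nonnegative subspaces\<close>

text \<open>The form cannot be both negative and nonnegative, so the subspaces meet only in 0 and
  their dimensions add.\<close>

lemma dim_nonneg_negative_definite:
  fixes f :: "'a::euclidean_space \<Rightarrow> 'a"
  assumes "subspace V" "subspace W"
    and "\<And>v. v \<in> V \<Longrightarrow> v \<noteq> 0 \<Longrightarrow> v \<bullet> f v < 0" "\<And>w. w \<in> W \<Longrightarrow> w \<bullet> f w \<ge> 0"
  shows "dim V + dim W \<le> DIM('a)"
proof -
  have "V \<inter> W \<subseteq> {0}" using assms(3,4) by force
  then have "dim (V \<inter> W) = 0" by (simp only: dim_eq_0)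
  then show ?thesis using dim_sums_Int[OF assms(1,2)] dim_subset_UNIV[of "{x + y |x y. x \<in> V \<and> y \<in> W}"]
    by linarith
qed

text \<open>If \<open>z \<bullet> g z > 0\<close>, then \<open>g z\<close> would extend \<open>L\<close> to a nonnegative subspace of too large a
  dimension.\<close>

theorem maximal_nonneg_orthogonal:
  fixes f g :: "'a::euclidean_space \<Rightarrow> 'a"
  assumes f: "linear f" "\<And>x y. x \<bullet> f y = f x \<bullet> y" and fg: "\<And>z. f (g z) = z"
    and V: "subspace V" "\<And>v. v \<in> V \<Longrightarrow> v \<noteq> 0 \<Longrightarrow> v \<bullet> f v < 0"
    and L: "subspace L" "\<And>l. l \<in> L \<Longrightarrow> l \<bullet> f l \<ge> 0"
    and dim: "dim V + dim L = DIM('a)"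
    and z: "\<And>l. l \<in> L \<Longrightarrow> l \<bullet> z = 0"
  shows "z \<bullet> g z \<le> 0"
proof (rule ccontr)
  assume *: "\<not> ?thesis"
  define y where "y = g z"
  have yz: "y \<bullet> z > 0" using * by (simp add: y_def inner_commute)
  have "y \<notin> span L" using z yz L(1) by (auto simp: span_eq_iff[THEN iffD2])
  then have "dim (insert y L) = Suc (dim L)" by (simp add: dim_insert)
  moreover have "dim V + dim (span (insert y L)) \<le> DIM('a)"
  proof (rule dim_nonneg_negative_definite[where f = f])
    fix w assume "w \<in> span (insert y L)"
    then obtain k where k: "w - k *\<^sub>R y \<in> L" using L(1) by (auto simp: span_insert span_eq_iff[THEN iffD2])
    define l where "l = w - k *\<^sub>R y"
    have w: "w = l + k *\<^sub>R y" by (simp add: l_def)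
    \<comment> \<open>These make the mixed term \<open>l \<bullet> f y = l \<bullet> z\<close>
      vanish in the expansion at \<open>l + k y\<close>.\<close>
    have "l \<bullet> z = 0" "f y = z" using k z by (auto simp: l_def y_def fg)
    moreover have "y \<bullet> f l = l \<bullet> f y" using f(2)[of y l] by (simp add: inner_commute)
    ultimately have "w \<bullet> f w = l \<bullet> f l + k\<^sup>2 * (y \<bullet> z)"
      unfolding w by (simp add: quadratic_form_add[OF f])
    then show "w \<bullet> f w \<ge> 0" using L(2)[of l] k yz by (simp add: l_def[symmetric])
  qed (use V in auto)
  ultimately show False using dim by (simp add: dim_span)
qed

subsection \<open>Block matrices\<close>

definition vjoin :: "real^'a \<Rightarrow> real^'b \<Rightarrow> real^('a + 'b)" where
  "vjoin v w = (\<chi> i. case i of Inl a \<Rightarrow> v $ a | Inr b \<Rightarrow> w $ b)"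

lemma vjoin_nth [simp]: "vjoin v w $ Inl a = v $ a" "vjoin v w $ Inr b = w $ b"
  by (simp_all add: vjoin_def)

lemma vjoin_eq_iff [simp]: "vjoin v w = vjoin v' w' \<longleftrightarrow> v = v' \<and> w = w'"
  by (metis vec_eq_iff vjoin_nth)

lemma vjoin_cases: obtains v w where "z = vjoin v w"
proof
  show "z = vjoin (\<chi> i. z $ Inl i) (\<chi> i. z $ Inr i)"
    by (simp add: vec_eq_iff vjoin_def split: sum.split)
qed

lemma vjoin_0 [simp]: "vjoin 0 0 = 0"
  by (simp add: vec_eq_iff vjoin_def split: sum.split)

lemma vjoin_eq_0_iff [simp]: "vjoin v w = 0 \<longleftrightarrow> v = 0 \<and> w = 0"
  by (metis vjoin_0 vjoin_eq_iff)

lemma vjoin_add: "vjoin v w + vjoin v' w' = vjoin (v + v') (w + w')"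
  and vjoin_scaleR: "c *\<^sub>R vjoin v w = vjoin (c *\<^sub>R v) (c *\<^sub>R w)"
  by (simp_all add: vec_eq_iff vjoin_def split: sum.split)

lemma sum_UNIV_sum_type:
  fixes h :: "'a::finite + 'b::finite \<Rightarrow> 'c::comm_monoid_add"
  shows "sum h UNIV = (\<Sum>a\<in>UNIV. h (Inl a)) + (\<Sum>b\<in>UNIV. h (Inr b))"
  by (simp add: UNIV_Plus_UNIV[symmetric] sum.Plus del: UNIV_Plus_UNIV)

lemma inner_vjoin: "vjoin v w \<bullet> vjoin v' w' = v \<bullet> v' + w \<bullet> w'"
  by (simp add: inner_vec_def sum_UNIV_sum_type)

lemma block_mat_vjoin: "block_mat A B C D *v vjoin v w = vjoin (A *v v + B *v w) (C *v v + D *v w)"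
  by (simp add: vec_eq_iff block_mat_def matrix_vector_mult_def sum_UNIV_sum_type vjoin_def split: sum.split)

lemma vstack_vec: "vstack A B *v v = vjoin (A *v v) (B *v v)"
  by (simp add: vec_eq_iff vstack_def matrix_vector_mult_def vjoin_def split: sum.split)

lemma block_mat_collapse: "block_mat (block11 M) (block12 M) (block21 M) (block22 M) = M"
  by (simp add: vec_eq_iff block_mat_def block11_def block12_def block21_def block22_def split: sum.split)

lemma transpose_block_mat:
  "transpose (block_mat A B C D) = block_mat (transpose A) (transpose C) (transpose B) (transpose D)"
  by (simp add: vec_eq_iff block_mat_def transpose_def split: sum.split)

lemma one_cons_eq: "one_cons v = vjoin 1 v"
  by (simp add: vec_eq_iff one_cons_def vjoin_def split: sum.split)

lemma linear_vjoin:
  assumes "linear f" "linear g"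
  shows "linear (\<lambda>x. vjoin (f x) (g x))"
  using assms by (intro linearI) (simp_all add: vjoin_add vjoin_scaleR linear_add linear_scale)

text \<open>Lagrange's identity in disguise: expand \<open>\<Sum>\<^sub>i\<^sub>j k(z\<^sub>i D\<^sub>j - z\<^sub>j D\<^sub>i) \<ge> 0\<close> for
  \<open>k(x) = x \<bullet> f x\<close>.\<close>

lemma psd_cauchy_schwarz_sum:
  fixes f :: "'a::real_inner \<Rightarrow> 'a" and D :: "'i \<Rightarrow> 'a"
  assumes f: "linear f" "\<And>x y. x \<bullet> f y = f x \<bullet> y" and pos: "\<And>x. x \<bullet> f x \<ge> 0" 
  shows "(\<Sum>i\<in>A. z i *\<^sub>R D i) \<bullet> f (\<Sum>i\<in>A. z i *\<^sub>R D i) \<le> (\<Sum>i\<in>A. (z i)\<^sup>2) * (\<Sum>i\<in>A. D i \<bullet> f (D i))"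
proof -
  have sw: "D j \<bullet> f (D i) = D i \<bullet> f (D j)" for i j using f(2)[of "D j" "D i"] by (simp add: inner_commute)
  have "0 \<le> (\<Sum>i\<in>A. \<Sum>j\<in>A. (z i *\<^sub>R D j - z j *\<^sub>R D i) \<bullet> f (z i *\<^sub>R D j - z j *\<^sub>R D i))"
    by (intro sum_nonneg pos)
  also have "\<dots> = (\<Sum>i\<in>A. \<Sum>j\<in>A. (z i)\<^sup>2 * (D j \<bullet> f (D j)) + (z j)\<^sup>2 * (D i \<bullet> f (D i))
      - 2 * (z i * z j * (D i \<bullet> f (D j))))"
    by (intro sum.cong refl)
      (simp add: linear_diff[OF f(1)] linear_scale[OF f(1)] inner_simps sw power2_eq_square algebra_simps)
  also have "\<dots> = 2 * ((\<Sum>i\<in>A. (z i)\<^sup>2) * (\<Sum>i\<in>A. D i \<bullet> f (D i)))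
      - 2 * (\<Sum>i\<in>A. \<Sum>j\<in>A. z i * z j * (D i \<bullet> f (D j)))"
  proof -
    have "(\<Sum>i\<in>A. \<Sum>j\<in>A. (z j)\<^sup>2 * (D i \<bullet> f (D i))) = (\<Sum>i\<in>A. \<Sum>j\<in>A. (z i)\<^sup>2 * (D j \<bullet> f (D j)))"
      by (rule sum.swap)
    then show ?thesis by (simp add: sum.distrib sum_subtractf sum_distrib_left[symmetric] sum_product)
  qed
  also have "(\<Sum>i\<in>A. \<Sum>j\<in>A. z i * z j * (D i \<bullet> f (D j))) =
      (\<Sum>i\<in>A. z i *\<^sub>R D i) \<bullet> f (\<Sum>i\<in>A. z i *\<^sub>R D i)"
    by (simp add: linear_sum[OF f(1)] linear_scale[OF f(1)] inner_sum_left inner_sum_right mult.assoc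
        sum_distrib_left) (subst sum.swap, simp add: mult.left_commute)
  finally show ?thesis by simp
qed

lemma minus_matrix_vec: "(- A) *v v = - (A *v (v :: real^'b))"
  by (simp add: matrix_vector_mult_def vec_eq_iff sum_negf)

lemma matrix_vec_minus: "A *v (- v) = - (A *v (v :: real^'b))"
  by (simp add: matrix_vector_mult_def vec_eq_iff sum_negf)

text \<open>A zero of a nonnegative form is a minimizer, so the derivative vanishes in every
  direction \<open>u\<close>; the direction \<open>M *v v\<close> finishes the proof.\<close>

lemma psd_kernel:
  fixes M :: "real^'k^'k"
  assumes "psd M" "v \<bullet> (M *v v) = 0"
  shows "M *v v = 0"
proof -
  note sym = symmetric_mat_inner[OF assms(1)[unfolded psd_def, THEN conjunct1]]
  have "- (u \<bullet> (M *v v)) = 0" for u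
  proof (rule quadratic_nonpos_imp_linear_zero)
    fix t
    have "0 \<le> (v + t *\<^sub>R u) \<bullet> (M *v (v + t *\<^sub>R u))" using assms(1) by (simp add: psd_def)
    also have "\<dots> = 2 * t * (u \<bullet> (M *v v)) + t\<^sup>2 * (u \<bullet> (M *v u))"
      using quadratic_form_add[OF matrix_vector_mul_linear[of M] sym, of v t u] assms(2) by simp
    finally show "2 * t * - (u \<bullet> (M *v v)) + t\<^sup>2 * - (u \<bullet> (M *v u)) \<le> 0" by simp
  qed
  from this[of "M *v v"] show ?thesis by simp
qed

lemma block_mat_mult:
  "block_mat A B C D ** block_mat A' B' C' D' =
    block_mat (A ** A' + B ** C') (A ** B' + B ** D') (C ** A' + D ** C') (C ** B' + D ** D')"
  by (simp add: vec_eq_iff block_mat_def matrix_matrix_mult_def sum_UNIV_sum_type split: sum.split)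

lemma symmetric_block_mat:
  "symmetric_mat (block_mat A B C D) \<longleftrightarrow> symmetric_mat A \<and> symmetric_mat D \<and> C = transpose B"
  unfolding symmetric_mat_def transpose_block_mat by (metis block_mat_blocks transpose_transpose)

lemma symmetric_blocks:
  assumes "symmetric_mat M"
  shows "symmetric_mat (block11 M)" "symmetric_mat (block22 M)" "block21 M = transpose (block12 M)"
  using assms symmetric_block_mat[of "block11 M" "block12 M" "block21 M" "block22 M"]
  by (simp_all add: block_mat_collapse)

section \<open>The data matrix as a quadratic form in the unknown system\<close>

lemma one_cons_form:
  fixes N :: "real^(1 + 'k)^(1 + 'k::finite)"
  assumes "symmetric_mat N"
  shows "one_cons v \<bullet> (N *v one_cons v) =
    N $ Inl 1 $ Inl 1 + 2 * (v \<bullet> column 1 (block21 N)) + v \<bullet> (block22 N *v v)"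
proof -
  have "N *v one_cons v = block_mat (block11 N) (block12 N) (block21 N) (block22 N) *v vjoin 1 v"
    by (simp add: block_mat_collapse one_cons_eq)
  also have "\<dots> = vjoin (block11 N *v 1 + block12 N *v v) (block21 N *v 1 + block22 N *v v)"
    by (rule block_mat_vjoin)
  finally have "one_cons v \<bullet> (N *v one_cons v) =
      1 \<bullet> (block11 N *v 1) + 1 \<bullet> (block12 N *v v) + v \<bullet> (block21 N *v 1) + v \<bullet> (block22 N *v v)"
    by (simp add: one_cons_eq inner_vjoin inner_add_right)
  moreover have "block21 N *v 1 = column 1 (block21 N)"
    by (simp add: vec_eq_iff matrix_vector_mult_def column_def)
  moreover have "(1 :: real^1) \<bullet> (block12 N *v v) = v \<bullet> (block21 N *v 1)"
    unfolding symmetric_blocks(3)[OF assms] by (metis dot_lmul_matrix inner_commute transpose_matrix_vector)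
  moreover have "(1 :: real^1) \<bullet> (block11 N *v 1) = N $ Inl 1 $ Inl 1"
    by (simp add: matrix_vector_mult_def inner_vec_def block11_def)
  ultimately show ?thesis by simp
qed

lemma schur_entry:
  fixes N :: "real^(1 + 'k)^(1 + 'k::finite)"
  assumes "symmetric_mat N"
  shows "schur N $ 1 $ 1 = N $ Inl 1 $ Inl 1 -
    column 1 (block21 N) \<bullet> (pinv (block22 N) *v column 1 (block21 N))"
proof -
  have 1: "(A ** B ** C) $ 1 $ 1 = row 1 A \<bullet> (B *v column 1 C)"
    for A :: "real^'k^1" and B :: "real^'k^'k" and C :: "real^1^'k"
    by (subst matrix_mul_assoc[symmetric]) (simp add: matrix_matrix_mult_def inner_vec_def row_def column_def
          matrix_vector_mult_def)
  show ?thesis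
    unfolding schur_def symmetric_blocks(3)[OF assms] by (simp add: 1 block11_def)
qed

lemma vectorize_diff: "vectorize (A - B) = vectorize A - vectorize B"
  by (simp add: vectorize_def vec_eq_iff)

text \<open>This explains the shape of \<open>E_mat\<close>: it sends a candidate system to the
  noise that this system would need in order to fit the data.\<close>

lemma E_mat_one_cons:
  "E_mat u x y *v one_cons (vectorize M) =
    one_cons (vectorize (Wplus x y - M ** Wminus x u))"
proof -
  have col: "columnvector v *v (1 :: real^1) = v" for v :: "real^'k"
    by (simp add: columnvector_def matrix_vector_mult_def vec_eq_iff)
  show ?thesis
    by (simp add: col minus_matrix_vec E_mat_def one_cons_eq block_mat_vjoin kron_mat1_vectorize vectorize_diff)
qed

lemma transpose_zero: "transpose 0 = (0 :: real^'a^'b)"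
  and transpose_minus: "transpose (- A) = - transpose (A :: real^'a^'b)"
  by (simp_all add: transpose_def vec_eq_iff)

lemma transpose_congruence_form:
  fixes L :: "real^'k^'l"
  shows "v \<bullet> ((transpose L ** M ** L) *v w) = (L *v v) \<bullet> (M *v (L *v w))"
  by (simp add: matrix_vector_mul_assoc[symmetric] inner_commute[of v] dot_lmul_matrix)
    (rule inner_commute)

lemma symmetric_congruence:
  fixes L :: "real^'k^'l"
  assumes "symmetric_mat M"
  shows "symmetric_mat (transpose L ** M ** L)"
  using assms by (simp add: symmetric_mat_def matrix_transpose_mul matrix_mul_assoc)

text \<open>The data equation determines \<open>E\<close> as the residual, which removes the
  existential quantifier; the congruence by \<open>E_mat\<close> does the rest.\<close>

lemma compatible_systems_iff:
  "(A, B, C, D) \<in> compatible_systems \<Xi> u x y \<longleftrightarrow>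
    one_cons (vectorize (block_mat A B C D)) \<bullet>
      (N_mat \<Xi> u x y *v one_cons (vectorize (block_mat A B C D))) \<ge> 0"
proof -
  have *: "Wplus x y = block_mat A B C D ** Wminus x u + E \<longleftrightarrow>
      E = Wplus x y - block_mat A B C D ** Wminus x u" for E
    by (auto simp: algebra_simps)
  then show ?thesis
    unfolding compatible_systems_def N_mat_def transpose_congruence_form E_mat_one_cons by (simp add: *)
qed

lemma matrix_plus_rdistrib: "(B + C) ** D = B ** D + C ** (D :: real^'l^'m)"
  by (simp add: matrix_matrix_mult_def vec_eq_iff sum.distrib algebra_simps)

text \<open>Each term of the (1,2) block applies \<open>block12 \<Xi>\<close> or
  \<open>block22 \<Xi>\<close> after \<open>K\<close>. Hence the kernel inclusion assumed for
  \<open>\<Xi>\<close> can be passed on to \<open>N_mat\<close>.\<close>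

lemma N_mat_blocks:
  fixes u :: "nat \<Rightarrow> real^'m" and x :: "nat \<Rightarrow> real^'n" and y :: "nat \<Rightarrow> real^'p"
    and \<Xi> :: "real^(1 + 't \<times> ('n + 'p))^(1 + 't::{finite, linorder} \<times> ('n + 'p))"
  defines "K \<equiv> kron (transpose (Wminus x u :: real^'t::{finite, linorder}^('n + 'm))) (mat 1 :: real^('n + 'p)^('n + 'p))"
  shows "block22 (N_mat \<Xi> u x y) = transpose K ** block22 \<Xi> ** K"
    and "block12 (N_mat \<Xi> u x y) = - (block12 \<Xi> ** K) -
      transpose (columnvector (vectorize (Wplus x y))) ** block22 \<Xi> ** K"
proof -
  have neg: "(- A) ** B = - (A ** B)" "A ** (- B) = - (A ** B)"
    for A :: "real^'b^'a" and B :: "real^'c^'b"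
    by (simp_all add: matrix_matrix_mult_def vec_eq_iff sum_negf)
  have "N_mat \<Xi> u x y = transpose (E_mat u x y) **
      block_mat (block11 \<Xi>) (block12 \<Xi>) (block21 \<Xi>) (block22 \<Xi>) ** E_mat u x y"
    by (simp add: N_mat_def block_mat_collapse)
  note N = this[unfolded E_mat_def transpose_block_mat block_mat_mult, folded K_def]
  show "block22 (N_mat \<Xi> u x y) = transpose K ** block22 \<Xi> ** K"
    unfolding N by (simp add: neg transpose_zero transpose_minus)
  show "block12 (N_mat \<Xi> u x y) = - (block12 \<Xi> ** K) -
      transpose (columnvector (vectorize (Wplus x y))) ** block22 \<Xi> ** K"
    unfolding N by (simp add: neg transpose_zero transpose_minus matrix_plus_rdistrib)
qed

section \<open>Frobenius inner product and completion of squares\<close>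

lemma frobenius_mult:
  fixes A :: "real^'b^'a" and B :: "real^'c^'b"
  shows "(A ** B) \<bullet> C = A \<bullet> (C ** transpose B)"
proof -
  have "(A ** B) \<bullet> C = (\<Sum>i\<in>UNIV. \<Sum>j\<in>UNIV. \<Sum>k\<in>UNIV. A $ i $ k * B $ k $ j * C $ i $ j)"
    by (simp add: inner_vec_def matrix_matrix_mult_def sum_distrib_right)
  also have "\<dots> = (\<Sum>i\<in>UNIV. \<Sum>k\<in>UNIV. \<Sum>j\<in>UNIV. A $ i $ k * B $ k $ j * C $ i $ j)"
    by (intro sum.cong sum.swap refl)
  also have "\<dots> = A \<bullet> (C ** transpose B)"
    by (simp add: inner_vec_def matrix_matrix_mult_def transpose_def sum_distrib_left mult_ac)
  finally show ?thesis .
qed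

lemma row_mult_symmetric:
  fixes D :: "real^'b^'a"
  assumes "symmetric_mat Q"
  shows "(D ** Q) $ i = Q *v D $ i"
proof -
  have "(D ** Q) $ i = transpose Q *v D $ i"
    by (simp add: vec_eq_iff matrix_matrix_mult_def vector_matrix_mult_def mult.commute)
  then show ?thesis using assms by (simp only: symmetric_mat_def)
qed

lemma frobenius_form_rows:
  fixes D :: "real^'b^'a"
  assumes "symmetric_mat Q"
  shows "D \<bullet> (D ** Q) = (\<Sum>i\<in>UNIV. D $ i \<bullet> (Q *v D $ i))"
  unfolding inner_vec_def[of D] row_mult_symmetric[OF assms] ..

text \<open>The difference between \<open>v\<close> and \<open>pinv Q *v (Q *v v)\<close> lies in
  the kernel of \<open>Q\<close>, where \<open>B\<close> vanishes as well.\<close>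

lemma pinv_absorb:
  fixes Q :: "real^'b^'b" and B :: "real^'b^'a"
  assumes "symmetric_mat Q" "\<And>v. Q *v v = 0 \<Longrightarrow> B *v v = 0"
  shows "B ** pinv Q ** Q = B"
proof -
  have "Q *v (v - pinv Q *v (Q *v v)) = 0" for v
    using penrose_pinv_symmetric(1)[OF assms(1)]
    by (simp add: matrix_vector_mult_diff_distrib matrix_vector_mul_assoc penrose_def matrix_mul_assoc)
  from assms(2)[OF this] show ?thesis
    by (simp add: matrix_vector_mult_diff_distrib matrix_vector_mul_assoc matrix_eq matrix_mul_assoc)
qed

text \<open>The center is \<open>- (B ** pinv Q)\<close>; the absorption hypothesis makes
  \<open>Q\<close> turn the shift back into \<open>B\<close>, which supplies the linear
  term.\<close>

lemma frobenius_complete_square: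
  fixes Q :: "real^'b^'b" and B M :: "real^'b^'a"
  assumes "symmetric_mat Q" "B ** pinv Q ** Q = B"
  shows "2 * (M \<bullet> B) + M \<bullet> (M ** Q) =
    (M + B ** pinv Q) \<bullet> ((M + B ** pinv Q) ** Q) - B \<bullet> (B ** pinv Q)"
proof -
  let ?C = "B ** pinv Q"
  have "(M + ?C) ** Q = M ** Q + B" using assms(2) by (simp add: matrix_plus_rdistrib)
  moreover have "?C \<bullet> (M ** Q) = M \<bullet> B"
    using frobenius_mult[of M Q ?C] assms by (simp add: inner_commute symmetric_mat_def)
  ultimately show ?thesis by (simp add: inner_add_left inner_add_right inner_commute)
qed

text \<open>The summand \<open>B ** pinv Q ** transpose B\<close> of the first block is exactly what
  completes the square in \<open>w\<close>, leaving only \<open>c * (z \<bullet> z)\<close>.\<close>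

lemma quadratic_complete_square:
  fixes Q :: "real^'b^'b" and B :: "real^'b^'a"
  assumes Q: "symmetric_mat Q" and B: "B ** pinv Q ** Q = B"
  shows "vjoin z w \<bullet> (block_mat (c *\<^sub>R mat 1 + B ** pinv Q ** transpose B) B (transpose B) Q *v vjoin z w) =
    c * (z \<bullet> z) + (w + transpose (B ** pinv Q) *v z) \<bullet> (Q *v (w + transpose (B ** pinv Q) *v z))"
proof -
  let ?P = "pinv Q"
  define b where "b = transpose B *v z"
  have P: "symmetric_mat ?P" using penrose_pinv_symmetric(2)[OF Q] .
  have tr: "transpose (B ** ?P) *v z = ?P *v b"
    using P by (simp add: b_def matrix_transpose_mul symmetric_mat_def matrix_vector_mul_assoc
          del: transpose_matrix_vector)
  have zB: "z \<bullet> (B *v v) = b \<bullet> v" for v by (simp add: b_def dot_lmul_matrix)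
  have "transpose (B ** ?P ** Q) = transpose B" using B by simp
  then have "Q *v (?P *v b) = b"
    using P Q by (simp add: b_def matrix_transpose_mul symmetric_mat_def matrix_vector_mul_assoc
          matrix_mul_assoc del: transpose_matrix_vector)
  moreover have "(?P *v b) \<bullet> (Q *v w) = w \<bullet> (Q *v (?P *v b))"
    using symmetric_mat_inner[OF Q, of w "?P *v b"] by (simp add: inner_commute)
  ultimately show ?thesis
    unfolding tr block_mat_vjoin inner_vjoin
    by (simp add: matrix_vector_mult_add_rdistrib matrix_vector_right_distrib inner_add_left inner_add_right
        scaleR_matrix_vector_assoc[symmetric] matrix_vector_mul_assoc[symmetric] zB b_def[symmetric]
        inner_commute del: transpose_matrix_vector)
qed

subsection \<open>The data ellipsoid\<close>

text \<open>Test matrices that reduce claims about the Frobenius form to claims about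
  \<open>Q\<close> acting on one vector.\<close>

definition single_row :: "'a \<Rightarrow> real^'b \<Rightarrow> real^'b^'a::finite" where
  "single_row i v = (\<chi> j. if j = i then v else 0)"

lemma inner_single_row: "B \<bullet> single_row i v = B $ i \<bullet> v"
  unfolding inner_vec_def[of B] by (simp add: single_row_def if_distrib cong: if_cong)

lemma single_row_mult:
  fixes Q :: "real^'b^'b"
  assumes "symmetric_mat Q"
  shows "single_row i v ** Q = single_row i (Q *v v)"
  by (subst vec_eq_iff) (simp only: row_mult_symmetric[OF assms], simp add: single_row_def)

text \<open>Since \<open>block22 N = kron Q (mat 1)\<close>, the form of \<open>N\<close> is a
  Frobenius form in the unknown matrix. Completing the square there and in \<open>Q_mat\<close>
  yields the same constant, the same \<open>Q\<close> and the same center \<open>M0\<close>, which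
  ties the compatible systems to the form of \<open>Q_mat\<close>.\<close>

theorem data_ellipsoid:
  fixes u :: "nat \<Rightarrow> real^'m" and x :: "nat \<Rightarrow> real^'n" and y :: "nat \<Rightarrow> real^'p"
    and \<Xi> :: "real^(1 + 't \<times> ('n + 'p))^(1 + 't::{finite, linorder} \<times> ('n + 'p))"
    and \<xi> :: "real^'t::{finite, linorder}^'t::{finite, linorder}"
  assumes \<Xi>: "\<Xi> \<in> Pi_set" and \<xi>: "symmetric_mat \<xi>" and kron: "block22 \<Xi> = kron \<xi> (mat 1)"
  obtains Q :: "real^('n + 'm)^('n + 'm)" and M0 :: "real^('n + 'm)^('n + 'p)"
  where "symmetric_mat Q" "\<And>v. v \<bullet> (Q *v v) \<le> 0" "symmetric_mat (Q_mat \<Xi> \<xi> u x y)"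
    "\<And>A B C D. (A, B, C, D) \<in> compatible_systems \<Xi> u x y \<longleftrightarrow>
       schur (N_mat \<Xi> u x y) $ 1 $ 1 + (block_mat A B C D - M0) \<bullet> ((block_mat A B C D - M0) ** Q) \<ge> 0"
    "\<And>z w. vjoin z w \<bullet> (Q_mat \<Xi> \<xi> u x y *v vjoin z w) =
       schur (N_mat \<Xi> u x y) $ 1 $ 1 * (z \<bullet> z) + (w - transpose M0 *v z) \<bullet> (Q *v (w - transpose M0 *v z))"
proof -
  let ?W = "Wminus x u :: real^'t::{finite, linorder}^('n + 'm)"
  let ?K = "kron (transpose ?W) (mat 1 :: real^('n + 'p)^('n + 'p))"
  define N where "N = N_mat \<Xi> u x y"
  define Q where "Q = ?W ** \<xi> ** transpose ?W"
  define B where "B = unvectorize (column 1 (block21 N))"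
  have B: "column 1 (block21 N) = vectorize B" by (simp add: B_def)
  have \<Xi>': "symmetric_mat \<Xi>" "psd (- block22 \<Xi>)"
    "\<And>v. block22 \<Xi> *v v = 0 \<Longrightarrow> block12 \<Xi> *v v = 0"
    using \<Xi> by (auto simp: Pi_set_def)
  have N: "symmetric_mat N" unfolding N_def N_mat_def by (rule symmetric_congruence[OF \<Xi>'(1)])
  have Q: "symmetric_mat Q"
    using symmetric_congruence[OF \<xi>, of "transpose ?W"] by (simp add: Q_def)
  have N22: "block22 N = kron Q (mat 1)"
    unfolding N_def N_mat_blocks(1) kron Q_def transpose_kron_mat1 kron_mat1_mult by simp
  have N22_vec: "block22 N *v vectorize M = vectorize (M ** Q)" for M :: "real^('n + 'm)^('n + 'p)"
    using Q by (simp add: N22 kron_mat1_vectorize symmetric_mat_def)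
  have N22_form: "v \<bullet> (block22 N *v v) = - ((?K *v v) \<bullet> (- block22 \<Xi> *v (?K *v v)))" for v
    unfolding N_def N_mat_blocks(1) transpose_congruence_form by (simp add: minus_matrix_vec)
  \<comment> \<open>Any row serves for the test matrix, hence the index
    \<open>undefined\<close>.\<close>
  have neg: "v \<bullet> (Q *v v) \<le> 0" for v
  proof -
    let ?M = "single_row undefined v :: real^('n + 'm)^('n + 'p)"
    have "v \<bullet> (Q *v v) = vectorize ?M \<bullet> (block22 N *v vectorize ?M)"
      unfolding N22_vec inner_vectorize single_row_mult[OF Q] inner_single_row by (simp add: single_row_def)
    also have "\<dots> \<le> 0" using \<Xi>'(2) unfolding N22_form by (simp add: psd_def)
    finally show ?thesis .
  qed
  \<comment> \<open>A null vector of \<open>Q\<close>, placed in row \<open>i\<close>, is a null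
    vector of \<open>block22 N\<close>. Semidefiniteness puts its image under \<open>?K\<close> into
    the kernel of \<open>block22 \<Xi>\<close>, hence of \<open>block12 \<Xi>\<close>; so the test
    matrix is orthogonal to \<open>B\<close>, and the \<open>i\<close>-th entry of
    \<open>B *v v\<close> is 0.\<close>
  have ker: "B *v v = 0" if v: "Q *v v = 0" for v
  proof -
    have "(B *v v) $ i = 0" for i
    proof -
      let ?M = "single_row i v :: real^('n + 'm)^('n + 'p)"
      have "block22 N *v vectorize ?M = 0"
        unfolding N22_vec single_row_mult[OF Q] v by (simp add: single_row_def vectorize_def vec_eq_iff)
      then have "(?K *v vectorize ?M) \<bullet> (- block22 \<Xi> *v (?K *v vectorize ?M)) = 0"
        using N22_form[of "vectorize ?M"] by simp
      from psd_kernel[OF \<Xi>'(2) this] have 22: "block22 \<Xi> *v (?K *v vectorize ?M) = 0"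
        by (simp add: minus_matrix_vec)
      with \<Xi>'(3) have 12: "block12 \<Xi> *v (?K *v vectorize ?M) = 0" by blast
      have "block12 N *v vectorize ?M = 0"
        unfolding N_def N_mat_blocks(2) using 12 22
        by (simp only: matrix_vector_mult_diff_rdistrib minus_matrix_vec matrix_vector_mul_assoc[symmetric])
          simp
      then have "row 1 (block12 N) \<bullet> vectorize ?M = 0"
        by (simp add: vec_eq_iff matrix_vector_mul_component row_def)
      then have "vectorize B \<bullet> vectorize ?M = 0"
        by (simp add: B[symmetric] symmetric_blocks(3)[OF N])
      then show ?thesis by (simp add: inner_vectorize inner_single_row matrix_vector_mul_component)
    qed
    then show ?thesis by (simp add: vec_eq_iff)
  qed
  note absorb = pinv_absorb[OF Q ker]
  have pN: "pinv (block22 N) *v vectorize M = vectorize (M ** pinv Q)" for M :: "real^('n + 'm)^('n + 'p)"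
    unfolding N22 pinv_kron_mat1[OF penrose_pinv_symmetric(1)[OF Q]] kron_mat1_vectorize
    using penrose_pinv_symmetric(2)[OF Q] by (simp add: symmetric_mat_def)
  have c: "schur N $ 1 $ 1 = N $ Inl 1 $ Inl 1 - B \<bullet> (B ** pinv Q)"
    unfolding schur_entry[OF N] B pN inner_vectorize ..
  define M0 where "M0 = - (B ** pinv Q)"
  have Qm: "Q_mat \<Xi> \<xi> u x y =
      block_mat (schur N $ 1 $ 1 *\<^sub>R mat 1 + B ** pinv Q ** transpose B) B (transpose B) Q"
    by (simp add: Q_mat_def Let_def N_def[symmetric] Q_def[symmetric] B_def[symmetric])
  show thesis
  proof
    show "symmetric_mat Q" "\<And>v. v \<bullet> (Q *v v) \<le> 0" by fact+
    have "symmetric_mat (schur N $ 1 $ 1 *\<^sub>R mat 1 + B ** pinv Q ** transpose B)"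
    proof -
      have add: "transpose (A + C) = transpose A + transpose C" for A C :: "real^'a^'a"
        by (simp add: transpose_def vec_eq_iff)
      show ?thesis
        using symmetric_congruence[OF penrose_pinv_symmetric(2)[OF Q], of "transpose B"]
        by (simp add: symmetric_mat_def add transpose_scalar)
    qed
    then show "symmetric_mat (Q_mat \<Xi> \<xi> u x y)"
      unfolding Qm symmetric_block_mat using Q by simp
  next
    fix A :: "real^'n^'n" and B' :: "real^'m^'n" and C :: "real^'n^'p" and D :: "real^'m^'p"
    let ?M = "block_mat A B' C D"
    have "one_cons (vectorize ?M) \<bullet> (N *v one_cons (vectorize ?M)) =
        schur N $ 1 $ 1 + (?M - M0) \<bullet> ((?M - M0) ** Q)"
      unfolding one_cons_form[OF N] B inner_vectorize N22_vec c M0_def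
      using frobenius_complete_square[OF Q absorb, of ?M] by simp
    then show "(A, B', C, D) \<in> compatible_systems \<Xi> u x y \<longleftrightarrow>
       schur (N_mat \<Xi> u x y) $ 1 $ 1 + (?M - M0) \<bullet> ((?M - M0) ** Q) \<ge> 0"
      unfolding compatible_systems_iff N_def[symmetric] by simp
  next
    fix z :: "real^('n + 'p)" and w :: "real^('n + 'm)"
    have "transpose M0 *v z = - (transpose (B ** pinv Q) *v z)"
      unfolding M0_def by (simp only: transpose_minus minus_matrix_vec)
    then show "vjoin z w \<bullet> (Q_mat \<Xi> \<xi> u x y *v vjoin z w) =
       schur (N_mat \<Xi> u x y) $ 1 $ 1 * (z \<bullet> z) + (w - transpose M0 *v z) \<bullet> (Q *v (w - transpose M0 *v z))"
      using quadratic_complete_square[OF Q absorb, of z w "schur N $ 1 $ 1"]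
      by (simp only: Qm N_def[symmetric]) simp
  qed
qed

text \<open>Only the vectors \<open>M\<^sup>T z\<close> enter the left-hand side, and a single such vector is always attained
  by a rank-one perturbation of the center \<open>M0\<close>; so the Frobenius ellipsoid may be replaced by the
  set where the form of \<open>R\<close> is nonnegative, to which the S-lemma applies. The points with \<open>z = 0\<close>
  are reached as limits.\<close>

theorem matrix_s_lemma:
  fixes Q :: "real^'b^'b" and M0 :: "real^'b^'a" and T R :: "real^('a + 'b)^('a + 'b)"
  assumes Q: "symmetric_mat Q" "\<And>v. v \<bullet> (Q *v v) \<le> 0" and c: "c > 0"
    and T: "symmetric_mat T" and R: "symmetric_mat R"
    and R_form: "\<And>z w. vjoin z w \<bullet> (R *v vjoin z w) =
       c * (z \<bullet> z) + (w - transpose M0 *v z) \<bullet> (Q *v (w - transpose M0 *v z))"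
  shows "(\<forall>M. c + (M - M0) \<bullet> ((M - M0) ** Q) \<ge> 0 \<longrightarrow>
            (\<forall>z. vjoin z (transpose M *v z) \<bullet> (T *v vjoin z (transpose M *v z)) \<ge> 0)) \<longleftrightarrow>
         (\<exists>\<alpha>\<ge>0. \<forall>v. v \<bullet> (T *v v) \<ge> \<alpha> * (v \<bullet> (R *v v)))" (is "?L \<longleftrightarrow> ?R")
proof
  assume L: ?L
  have imp1: "vjoin z w \<bullet> (T *v vjoin z w) \<ge> 0"
    if R0: "vjoin z w \<bullet> (R *v vjoin z w) \<ge> 0" and z: "z \<noteq> 0" for z w
  proof -
    define d where "d = w - transpose M0 *v z"
    \<comment> \<open>The correction \<open>z d^T / (z \<bullet> z)\<close> is chosen so that
      \<open>transpose M *v z = w\<close>. It contributes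
      \<open>(d \<bullet> (Q *v d)) / (z \<bullet> z)\<close> to the Frobenius form, so
      admissibility of \<open>M\<close> is \<open>R0\<close> divided by
      \<open>z \<bullet> z\<close>.\<close>
    define M where "M = M0 + (\<chi> i. (z $ i / (z \<bullet> z)) *\<^sub>R d)"
    have zz: "z \<bullet> z > 0" using z by simp
    have "(M - M0) \<bullet> ((M - M0) ** Q) = (\<Sum>i\<in>UNIV. (z $ i * z $ i) * ((d \<bullet> (Q *v d)) / (z \<bullet> z)\<^sup>2))"
      unfolding frobenius_form_rows[OF Q(1)]
      by (intro sum.cong) (simp_all add: M_def matrix_vector_mult_scaleR power2_eq_square)
    also have "\<dots> = (z \<bullet> z) * ((d \<bullet> (Q *v d)) / (z \<bullet> z)\<^sup>2)"
      by (simp only: sum_distrib_right[symmetric] inner_vec_def[of z] inner_real_def)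
    also have "\<dots> = (d \<bullet> (Q *v d)) / (z \<bullet> z)" using zz by (simp add: power2_eq_square)
    finally have "c + (M - M0) \<bullet> ((M - M0) ** Q) = (c * (z \<bullet> z) + d \<bullet> (Q *v d)) / (z \<bullet> z)"
      using zz by (simp add: field_simps)
    moreover have "c * (z \<bullet> z) + d \<bullet> (Q *v d) \<ge> 0" using R0 unfolding R_form d_def .
    ultimately have "c + (M - M0) \<bullet> ((M - M0) ** Q) \<ge> 0" using zz by simp
    moreover have "transpose M *v z = w"
    proof -
      have "(transpose M *v z) $ j = (transpose M0 *v z) $ j + (\<Sum>i\<in>UNIV. (z $ i * z $ i) * (d $ j / (z \<bullet> z)))" for j
        by (simp add: M_def vector_matrix_mult_def sum.distrib algebra_simps)
      also have "\<dots> j = (transpose M0 *v z) $ j + (z \<bullet> z) * (d $ j / (z \<bullet> z))" for j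
        by (simp only: sum_distrib_right[symmetric] inner_vec_def inner_real_def)
      also have "\<dots> j = w $ j" for j using zz by (simp add: d_def)
      finally show ?thesis by (simp add: vec_eq_iff)
    qed
    ultimately show ?thesis using L by blast
  qed
  have imp: "v \<bullet> (T *v v) \<ge> 0" if "v \<bullet> (R *v v) \<ge> 0" for v
  proof -
    obtain z w where v: "v = vjoin z w" by (rule vjoin_cases)
    show ?thesis
    proof (cases "z = 0")
      case False then show ?thesis using imp1 that v by simp
    next
      case True
      \<comment> \<open>Moving along \<open>(z1, transpose M0 *v z1)\<close> leaves the shifted
        vector \<open>w - transpose M0 *v z\<close> unchanged, so the form of \<open>R\<close> stays
        nonnegative while the first component becomes nonzero.\<close>
      obtain z1 :: "real^'a" where z1: "z1 \<noteq> 0" by (metis zero_neq_one)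
      define w1 where "w1 = transpose M0 *v z1"
      have wQ: "w \<bullet> (Q *v w) \<ge> 0" using that R_form[of 0 w] unfolding v True by simp
      define \<phi> where "\<phi> t = vjoin (t *\<^sub>R z1) (w + t *\<^sub>R w1)" for t
      have \<phi>: "\<phi> t = v + t *\<^sub>R vjoin z1 w1" for t
        by (simp add: \<phi>_def v True vjoin_add vjoin_scaleR)
      have pos: "\<phi> t \<bullet> (T *v \<phi> t) \<ge> 0" if "t > 0" for t
        unfolding \<phi>_def
      proof (rule imp1)
        have eq: "w + t *\<^sub>R w1 - transpose M0 *v (t *\<^sub>R z1) = w"
          by (simp add: w1_def matrix_vector_mult_scaleR del: transpose_matrix_vector)
        show "0 \<le> vjoin (t *\<^sub>R z1) (w + t *\<^sub>R w1) \<bullet> (R *v vjoin (t *\<^sub>R z1) (w + t *\<^sub>R w1))"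
          unfolding R_form eq by (intro add_nonneg_nonneg mult_nonneg_nonneg inner_ge_zero wQ less_imp_le[OF c])
      qed (use that z1 in simp)
      have "((\<lambda>t. \<phi> t \<bullet> (T *v \<phi> t)) \<longlongrightarrow> \<phi> 0 \<bullet> (T *v \<phi> 0)) (at_right 0)"
        unfolding \<phi>
        by (intro tendsto_intros linear_continuous_at bounded_linear.tendsto[OF matrix_vector_mul_bounded_linear])
      then have "\<phi> 0 \<bullet> (T *v \<phi> 0) \<ge> 0"
        by (rule tendsto_lowerbound) (auto simp: eventually_at_right_less pos intro: eventually_at_rightI[of 0 1])
      then show ?thesis by (simp add: \<phi>)
    qed
  qed
  \<comment> \<open>The center \<open>M0\<close> supplies the Slater point, with value
    \<open>c * (z \<bullet> z)\<close>.\<close>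
  obtain z :: "real^'a" where z: "z \<noteq> 0" by (metis zero_neq_one)
  have "vjoin z (transpose M0 *v z) \<bullet> (R *v vjoin z (transpose M0 *v z)) > 0"
    unfolding R_form using c z by simp
  from s_lemma[OF _ symmetric_mat_inner[OF R] _ symmetric_mat_inner[OF T] this imp]
  show ?R by (simp add: matrix_vector_mul_linear)
next
  assume ?R
  then obtain \<alpha> where \<alpha>: "\<alpha> \<ge> 0" "\<And>v. v \<bullet> (T *v v) \<ge> \<alpha> * (v \<bullet> (R *v v))" by blast
  show ?L
  proof (intro allI impI)
    fix M z assume M: "c + (M - M0) \<bullet> ((M - M0) ** Q) \<ge> 0"
    let ?v = "vjoin z (transpose M *v z)"
    let ?D = "\<lambda>i. (M - M0) $ i"
    \<comment> \<open>The displacement combines the rows of \<open>M - M0\<close> with coefficients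
      \<open>z\<close>, so the Cauchy-Schwarz bound for the nonnegative form of \<open>- Q\<close>
      controls it by the Frobenius form.\<close>
    have d: "transpose M *v z - transpose M0 *v z = (\<Sum>i\<in>UNIV. z $ i *\<^sub>R ?D i)"
      by (simp add: vec_eq_iff vector_matrix_mult_def sum_subtractf algebra_simps)
    have nQ: "linear (\<lambda>v. - (Q *v v))" by (intro linear_compose_neg matrix_vector_mul_linear)
    have nQ': "a \<bullet> - (Q *v b) = - (Q *v a) \<bullet> b" for a b
      using symmetric_mat_inner[OF Q(1)] by simp
    have "(\<Sum>i\<in>UNIV. z $ i *\<^sub>R ?D i) \<bullet> - (Q *v (\<Sum>i\<in>UNIV. z $ i *\<^sub>R ?D i)) \<le>
        (\<Sum>i\<in>UNIV. (z $ i)\<^sup>2) * (\<Sum>i\<in>UNIV. ?D i \<bullet> - (Q *v ?D i))"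
      by (rule psd_cauchy_schwarz_sum[OF nQ nQ']) (use Q in simp)
    also have "(\<Sum>i\<in>UNIV. (z $ i)\<^sup>2) = z \<bullet> z" by (simp add: inner_vec_def power2_eq_square)
    also have "(\<Sum>i\<in>UNIV. ?D i \<bullet> - (Q *v ?D i)) = - ((M - M0) \<bullet> ((M - M0) ** Q))"
      unfolding frobenius_form_rows[OF Q(1)] by (simp add: sum_negf)
    also have "(z \<bullet> z) * \<dots> \<le> (z \<bullet> z) * c" using M by (intro mult_left_mono) auto
    finally have "?v \<bullet> (R *v ?v) \<ge> 0" unfolding R_form d by (simp add: mult.commute)
    then have "0 \<le> \<alpha> * (?v \<bullet> (R *v ?v))" using \<alpha> by simp
    with \<alpha>(2)[of ?v] show "0 \<le> ?v \<bullet> (T *v ?v)" by linarith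
  qed
qed

subsection \<open>Duality of dissipation inequalities\<close>

lemma matrix_inv_inverse:
  fixes A :: "real^'k^'k"
  assumes "invertible A"
  shows "A ** matrix_inv A = mat 1" "matrix_inv A ** A = mat 1"
  using someI_ex[OF assms[unfolded invertible_def]] by (auto simp: matrix_inv_def)

lemma symmetric_matrix_inv:
  fixes A :: "real^'k^'k"
  assumes "symmetric_mat A" "invertible A"
  shows "symmetric_mat (matrix_inv A)"
proof (rule symmetric_matI)
  fix v w
  have inv: "A *v (matrix_inv A *v v) = v" for v
    using matrix_inv_inverse(1)[OF assms(2)] by (simp add: matrix_vector_mul_assoc)
  have "v \<bullet> (matrix_inv A *v w) = (A *v (matrix_inv A *v v)) \<bullet> (matrix_inv A *v w)" by (simp add: inv)
  also have "\<dots> = (matrix_inv A *v v) \<bullet> (A *v (matrix_inv A *v w))"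
    by (rule symmetric_mat_inner[OF assms(1), symmetric])
  also have "\<dots> = (matrix_inv A *v v) \<bullet> w" by (simp only: inv)
  finally show "v \<bullet> (matrix_inv A *v w) = (matrix_inv A *v v) \<bullet> w" .
qed

lemma pd_invertible: "pd P \<Longrightarrow> invertible P"
  unfolding invertible_left_inverse matrix_left_invertible_ker pd_def by force

lemma pd_matrix_inv:
  assumes "pd P"
  shows "pd (matrix_inv P)"
proof -
  note inv = pd_invertible[OF assms]
  have sym: "symmetric_mat (matrix_inv P)" using assms inv by (simp add: pd_def symmetric_matrix_inv)
  have "v \<bullet> (matrix_inv P *v v) > 0" if "v \<noteq> 0" for v
  proof -
    define w where "w = matrix_inv P *v v"
    have v: "v = P *v w" using matrix_inv_inverse(1)[OF inv] by (simp add: w_def matrix_vector_mul_assoc)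
    with that have "w \<noteq> 0" by auto
    then have "w \<bullet> (P *v w) > 0" using assms by (simp add: pd_def)
    then show ?thesis by (metis v w_def inner_commute)
  qed
  with sym show ?thesis by (simp add: pd_def)
qed

lemma dim_range_injective:
  fixes h :: "'a::euclidean_space \<Rightarrow> 'b::euclidean_space"
  assumes "linear h" "\<And>x. h x = 0 \<Longrightarrow> x = 0"
  shows "subspace (range h)" "dim (range h) = DIM('a)"
proof -
  have "inj h" using assms linear_injective_0 by blast
  then show "dim (range h) = DIM('a)" using dim_image_eq[OF assms(1), of UNIV] by simp
  show "subspace (range h)" by (intro linear_subspace_image assms subspace_UNIV)
qed

lemma linear_prod:
  assumes "linear f" "linear g"
  shows "linear (\<lambda>x. (f x, g x))"
  using assms by (intro linearI) (simp_all add: linear_add linear_scale)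

lemma linear_matrix_comp: "linear f \<Longrightarrow> linear (\<lambda>x. (A :: real^'k^'l) *v f x)"
  by (intro linearI) (simp_all add: linear_add linear_scale matrix_vector_right_distrib matrix_vector_mult_scaleR)

lemma linear_compose_scaleR_left: "linear f \<Longrightarrow> linear (\<lambda>x. f x *\<^sub>R v)"
  by (intro linearI) (simp_all add: linear_add linear_scale scaleR_add_left)

lemmas linear_block_intros = linear_prod linear_vjoin linear_matrix_comp linear_compose_add linear_compose_neg
  linear_fst linear_snd linear_ident linear_compose_scaleR_left

definition dissip :: "real^'n^'n \<Rightarrow> real^('m + 'p)^('m + 'p) \<Rightarrow>
    real^'n^'n \<Rightarrow> real^'m^'n \<Rightarrow> real^'n^'p \<Rightarrow> real^'m^'p \<Rightarrow> real^'n \<Rightarrow> real^'m \<Rightarrow> real" where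
  "dissip P S A B C D x u = x \<bullet> (P *v x) - (A *v x + B *v u) \<bullet> (P *v (A *v x + B *v u)) +
     vjoin u (C *v x + D *v u) \<bullet> (S *v vjoin u (C *v x + D *v u))"

text \<open>The negative of the form diag(\<open>R\<close>, \<open>- R\<close>, \<open>T\<close>) on
  the complement of the graph; the minus sign on the input part comes from orthogonality.\<close>

definition dual_dissip :: "real^'n^'n \<Rightarrow> real^('m + 'p)^('m + 'p) \<Rightarrow>
    real^'n^'n \<Rightarrow> real^'m^'n \<Rightarrow> real^'n^'p \<Rightarrow> real^'m^'p \<Rightarrow> real^'n \<Rightarrow> real^'p \<Rightarrow> real" where
  "dual_dissip R T A B C D z1 z2 = z1 \<bullet> (R *v z1) -
     (transpose A *v z1 + transpose C *v z2) \<bullet> (R *v (transpose A *v z1 + transpose C *v z2)) -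
     vjoin (- (transpose B *v z1 + transpose D *v z2)) z2 \<bullet>
       (T *v vjoin (- (transpose B *v z1 + transpose D *v z2)) z2)"

text \<open>The graph \<open>(x, Ax + Bu, (u, Cx + Du))\<close> and \<open>(- w\<^sub>1, z\<^sub>1, (- w\<^sub>2, z\<^sub>2))\<close> with
  \<open>w = M\<^sup>T z\<close> are orthogonal complements of each other.\<close>

theorem dissipation_duality:
  fixes P R :: "real^'n^'n" and S T :: "real^('m::finite + 'p::finite)^('m + 'p)"
  assumes P: "pd P" and R: "pd R" and PR: "P ** R = mat 1" "R ** P = mat 1"
    and S: "symmetric_mat S" and T: "symmetric_mat T" and ST: "S ** T = mat 1" "T ** S = mat 1"
    and neg: "eigenvalue_count S {..<0} = CARD('p)" and pos: "eigenvalue_count S {0<..} = CARD('m)"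
  shows "(\<forall>x u. dissip P S A B C D x u \<ge> 0) \<longleftrightarrow> (\<forall>z1 z2. dual_dissip R T A B C D z1 z2 \<ge> 0)"
proof -
  \<comment> \<open>Mutually inverse indefinite forms: diag(\<open>P\<close>, \<open>- P\<close>,
    \<open>S\<close>) and diag(\<open>R\<close>, \<open>- R\<close>, \<open>T\<close>).\<close>
  define f :: "(real^'n) \<times> (real^'n) \<times> (real^('m + 'p)) \<Rightarrow> _"
    where "f e = (P *v fst e, - (P *v fst (snd e)), S *v snd (snd e))" for e
  define g :: "(real^'n) \<times> (real^'n) \<times> (real^('m + 'p)) \<Rightarrow> _"
    where "g e = (R *v fst e, - (R *v fst (snd e)), T *v snd (snd e))" for e
  have Ps: "symmetric_mat P" "symmetric_mat R" using P R by (auto simp: pd_def)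
  have lin: "linear f" "linear g" unfolding f_def g_def
    by (intro linear_block_intros linear_compose[OF linear_snd linear_fst, unfolded o_def]
        linear_compose[OF linear_snd linear_snd, unfolded o_def])+
  have fs: "a \<bullet> f b = f a \<bullet> b" "a \<bullet> g b = g a \<bullet> b" for a b
    using symmetric_mat_inner[OF Ps(1)] symmetric_mat_inner[OF Ps(2)]
      symmetric_mat_inner[OF S] symmetric_mat_inner[OF T]
    by (auto simp: f_def g_def inner_prod_def)
  have fg: "f (g e) = e" "g (f e) = e" for e
    by (simp_all add: f_def g_def matrix_vec_minus matrix_vector_mul_assoc PR ST)
  define \<phi> where "\<phi> e = (fst e, A *v fst e + B *v snd e, vjoin (snd e) (C *v fst e + D *v snd e))" for e
  define \<psi> where "\<psi> e = (- (transpose A *v fst e + transpose C *v snd e), fst e,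
     vjoin (- (transpose B *v fst e + transpose D *v snd e)) (snd e))" for e
  have \<phi>: "linear \<phi>" "\<And>e. \<phi> e = 0 \<Longrightarrow> e = 0"
    and \<psi>: "linear \<psi>" "\<And>e. \<psi> e = 0 \<Longrightarrow> e = 0"
  proof -
    show "linear \<phi>" "linear \<psi>" unfolding \<phi>_def \<psi>_def by (intro linear_block_intros)+
    show "\<phi> e = 0 \<Longrightarrow> e = 0" for e
      unfolding \<phi>_def zero_prod_def by (auto simp: prod_eq_iff)
    show "\<psi> e = 0 \<Longrightarrow> e = 0" for e
      unfolding \<psi>_def zero_prod_def by (auto simp: prod_eq_iff)
  qed
  have orth: "\<phi> e \<bullet> \<psi> e' = 0" for e e'
  proof -
    have "(X *v v) \<bullet> w = v \<bullet> (transpose X *v w)" for X :: "real^'a^'b" and v w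
      by (metis dot_lmul_matrix inner_commute transpose_matrix_vector)
    note t = this
    show ?thesis
      by (simp add: \<phi>_def \<psi>_def inner_prod_def inner_vjoin inner_add_left inner_add_right
          inner_diff_right t del: transpose_matrix_vector)
  qed
  have f\<phi>: "\<phi> (x, u) \<bullet> f (\<phi> (x, u)) = dissip P S A B C D x u" for x u
    by (simp add: \<phi>_def f_def dissip_def inner_prod_def)
  have g\<psi>: "\<psi> (z1, z2) \<bullet> g (\<psi> (z1, z2)) = - dual_dissip R T A B C D z1 z2" for z1 z2
    by (simp add: \<psi>_def g_def dual_dissip_def inner_prod_def matrix_vec_minus
        del: transpose_matrix_vector minus_add_distrib)
  show ?thesis
  proof
    assume *: "\<forall>x u. dissip P S A B C D x u \<ge> 0"
    \<comment> \<open>With this \<open>V\<close>, \<open>{0} \<times> UNIV \<times> V\<close> is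
      negative definite for \<open>f\<close> and has dimension n + p, complementary to the dimension
      n + m of the graph.\<close>
    obtain V where V: "subspace V" "dim V = CARD('p)" "\<And>v. v \<in> V \<Longrightarrow> v \<noteq> 0 \<Longrightarrow> v \<bullet> (S *v v) < 0"
      using definite_subspace[OF S, of "- 1"] neg by (auto simp: lessThan_def)
    show "\<forall>z1 z2. dual_dissip R T A B C D z1 z2 \<ge> 0"
    proof (intro allI)
      fix z1 z2
      have "\<psi> (z1, z2) \<bullet> g (\<psi> (z1, z2)) \<le> 0"
      proof (rule maximal_nonneg_orthogonal[OF lin(1) fs(1) fg(1),
            where V = "{0} \<times> UNIV \<times> V" and L = "range \<phi>"])
        show "subspace ({0 :: real^'n} \<times> (UNIV :: (real^'n) set) \<times> V)"
          by (intro subspace_Times subspace_UNIV V subspace_single_0)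
        show "dim ({0 :: real^'n} \<times> (UNIV :: (real^'n) set) \<times> V) + dim (range \<phi>) =
            DIM((real^'n) \<times> (real^'n) \<times> (real^('m + 'p)))"
          using dim_range_injective(2)[OF \<phi>]
          by (simp add: dim_Times subspace_Times V subspace_single_0)
        show "subspace (range \<phi>)" by (rule dim_range_injective[OF \<phi>])
        show "v \<bullet> f v < 0" if v: "v \<in> {0} \<times> UNIV \<times> V" and v0: "v \<noteq> 0" for v
        proof -
          obtain b s where v_eq: "v = (0, b, s)" "s \<in> V" using v by auto
          have "b \<bullet> (P *v b) \<ge> 0" "b \<noteq> 0 \<Longrightarrow> b \<bullet> (P *v b) > 0"
            using P by (cases "b = 0"; simp add: pd_def less_imp_le)+
          moreover have "s \<bullet> (S *v s) \<le> 0" "s \<noteq> 0 \<Longrightarrow> s \<bullet> (S *v s) < 0"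
            using V v_eq by (cases "s = 0"; simp add: less_imp_le)+
          moreover have "b \<noteq> 0 \<or> s \<noteq> 0" using v0 by (auto simp: v_eq zero_prod_def)
          moreover have "v \<bullet> f v = s \<bullet> (S *v s) - b \<bullet> (P *v b)"
            by (simp add: v_eq f_def inner_prod_def)
          ultimately show ?thesis by linarith
        qed
        show "0 \<le> l \<bullet> f l" if "l \<in> range \<phi>" for l
          using that * by (auto simp: f\<phi>)
        show "l \<bullet> \<psi> (z1, z2) = 0" if "l \<in> range \<phi>" for l using that orth by auto
      qed
      then show "dual_dissip R T A B C D z1 z2 \<ge> 0" by (simp add: g\<psi>)
    qed
  next
    assume *: "\<forall>z1 z2. dual_dissip R T A B C D z1 z2 \<ge> 0"
    \<comment> \<open>For the converse both forms change roles and sign, so a positive definite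
      subspace of \<open>T\<close> is required: the image under \<open>S\<close> of one for
      \<open>S\<close>.\<close>
    obtain V0 where V0: "subspace V0" "dim V0 = CARD('m)" "\<And>v. v \<in> V0 \<Longrightarrow> v \<noteq> 0 \<Longrightarrow> v \<bullet> (S *v v) > 0"
      using definite_subspace[OF S, of 1] pos by (auto simp: greaterThan_def)
    have inj: "inj ((*v) S)" by (rule injI) (metis ST(2) matrix_vector_mul_assoc matrix_vector_mul_lid)
    define V where "V = (*v) S ` V0"
    have V: "subspace V" "dim V = CARD('m)"
      unfolding V_def using V0 inj dim_image_eq[OF matrix_vector_mul_linear, of S V0]
      by (auto intro: linear_subspace_image inj_on_subset)
    have VT: "v \<bullet> (T *v v) > 0" if "v \<in> V" "v \<noteq> 0" for v
    proof -
      obtain s where s: "s \<in> V0" "v = S *v s" using \<open>v \<in> V\<close> by (auto simp: V_def)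
      then have "s \<noteq> 0" using \<open>v \<noteq> 0\<close> by auto
      moreover have "v \<bullet> (T *v v) = s \<bullet> (S *v s)" by (simp add: s matrix_vector_mul_assoc ST inner_commute)
      ultimately show ?thesis using V0 s by simp
    qed
    show "\<forall>x u. dissip P S A B C D x u \<ge> 0"
    proof (intro allI)
      fix x u
      have "\<phi> (x, u) \<bullet> - f (\<phi> (x, u)) \<le> 0"
      proof (rule maximal_nonneg_orthogonal[where f = "\<lambda>e. - g e" and g = "\<lambda>e. - f e"
            and V = "UNIV \<times> {0} \<times> V" and L = "range \<psi>"])
        show "linear (\<lambda>e. - g e)" by (intro linear_compose_neg lin)
        show "a \<bullet> - g b = - g a \<bullet> b" for a b by (simp add: fs)
        show "- g (- f e) = e" for e using linear_neg[OF lin(2), of "f e"] by (simp add: fg)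
        show "subspace ((UNIV :: (real^'n) set) \<times> {0 :: real^'n} \<times> V)"
          by (intro subspace_Times subspace_UNIV V subspace_single_0)
        show "dim ((UNIV :: (real^'n) set) \<times> {0 :: real^'n} \<times> V) + dim (range \<psi>) =
            DIM((real^'n) \<times> (real^'n) \<times> (real^('m + 'p)))"
          using dim_range_injective(2)[OF \<psi>]
          by (simp add: dim_Times subspace_Times V subspace_single_0)
        show "subspace (range \<psi>)" by (rule dim_range_injective[OF \<psi>])
        show "v \<bullet> - g v < 0" if v: "v \<in> UNIV \<times> {0} \<times> V" and v0: "v \<noteq> 0" for v
        proof -
          obtain b s where v_eq: "v = (b, 0, s)" "s \<in> V" using v by auto
          have "b \<bullet> (R *v b) \<ge> 0" "b \<noteq> 0 \<Longrightarrow> b \<bullet> (R *v b) > 0"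
            using R by (cases "b = 0"; simp add: pd_def less_imp_le)+
          moreover have "s \<bullet> (T *v s) \<ge> 0" "s \<noteq> 0 \<Longrightarrow> s \<bullet> (T *v s) > 0"
            using VT v_eq by (cases "s = 0"; simp add: less_imp_le)+
          moreover have "b \<noteq> 0 \<or> s \<noteq> 0" using v0 by (auto simp: v_eq zero_prod_def)
          moreover have "v \<bullet> - g v = - (s \<bullet> (T *v s)) - b \<bullet> (R *v b)"
            by (simp add: v_eq g_def inner_prod_def)
          ultimately show ?thesis by linarith
        qed
        show "0 \<le> l \<bullet> - g l" if "l \<in> range \<psi>" for l
          using that * by (auto simp: g\<psi>)
        show "l \<bullet> \<phi> (x, u) = 0" if "l \<in> range \<psi>" for l using that orth by (auto simp: inner_commute)
      qed
      then show "dissip P S A B C D x u \<ge> 0" by (simp add: f\<phi>)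
    qed
  qed
qed

text \<open>If \<open>P x0 = 0\<close> and \<open>C x0 \<noteq> 0\<close>, the supply rate would be nonnegative on the \<open>(m + 1)\<close>-dimensional
  space of all \<open>(u, t C x0 + D u)\<close>, contradicting its \<open>p\<close> negative eigenvalues; and \<open>C x0 \<noteq> 0\<close> can
  be arranged since the center of the data ellipsoid is an interior point.\<close>

lemma storage_positive_definite:
  fixes P :: "real^'n^'n" and S :: "real^('m::finite + 'p::finite)^('m + 'p)" and Q :: "real^('n + 'm)^('n + 'm)"
  assumes P: "psd P" and S: "symmetric_mat S" and neg: "eigenvalue_count S {..<0} = CARD('p)"
    and c: "c > 0"
    and diss: "\<And>A B C D x u. c + (block_mat A B C D - M0) \<bullet> ((block_mat A B C D - M0) ** Q) \<ge> 0 \<Longrightarrow>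
      dissip P S A B C D x u \<ge> 0"
  shows "pd P"
proof (rule ccontr)
  assume "\<not> pd P"
  then obtain x0 where x0: "x0 \<noteq> 0" "x0 \<bullet> (P *v x0) = 0"
    using P by (auto simp: pd_def psd_def not_less intro: antisym)
  obtain A B C D where M: "c + (block_mat A B C D - M0) \<bullet> ((block_mat A B C D - M0) ** Q) \<ge> 0"
    and Cx: "C *v x0 \<noteq> 0"
  proof (cases "block21 M0 *v x0 = 0")
    case False
    with c show thesis
      by (intro that[of "block11 M0" "block12 M0" "block21 M0" "block22 M0"]) (simp_all add: block_mat_collapse)
  next
    case True
    \<comment> \<open>Every entry of \<open>C1 *v x0\<close> is \<open>x0 \<bullet> x0 > 0\<close>,
      and \<open>\<epsilon>\<close> is small enough for the change of the Frobenius form to stay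
      within the slack \<open>c\<close>.\<close>
    define C1 :: "real^'n^'p" where "C1 = (\<chi> i. x0)"
    define E :: "real^('n + 'm)^('n + 'p)" where "E = block_mat 0 0 C1 0"
    define k where "k = E \<bullet> (E ** Q)"
    define \<epsilon> where "\<epsilon> = sqrt (c / (\<bar>k\<bar> + 1))"
    have \<epsilon>: "\<epsilon> > 0" "\<epsilon>\<^sup>2 = c / (\<bar>k\<bar> + 1)" using c by (simp_all add: \<epsilon>_def add_nonneg_pos)
    have "\<epsilon>\<^sup>2 * \<bar>k\<bar> \<le> c" using c unfolding \<epsilon> by (simp add: field_simps)
    moreover have "\<epsilon>\<^sup>2 * \<bar>k\<bar> = \<bar>\<epsilon>\<^sup>2 * k\<bar>" by (simp add: abs_mult)
    ultimately have "c + \<epsilon>\<^sup>2 * k \<ge> 0" by linarith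
    moreover have "block_mat (block11 M0) (block12 M0) (block21 M0 + \<epsilon> *\<^sub>R C1) (block22 M0) - M0 = \<epsilon> *\<^sub>R E"
      by (simp add: E_def vec_eq_iff block_mat_def block11_def block12_def block21_def block22_def split: sum.split)
    moreover have "(\<epsilon> *\<^sub>R E) \<bullet> ((\<epsilon> *\<^sub>R E) ** Q) = \<epsilon>\<^sup>2 * k"
      by (simp add: k_def scalar_matrix_assoc[symmetric] power2_eq_square)
    moreover have "(block21 M0 + \<epsilon> *\<^sub>R C1) *v x0 \<noteq> 0"
    proof -
      have "(block21 M0 + \<epsilon> *\<^sub>R C1) *v x0 = \<epsilon> *\<^sub>R (C1 *v x0)"
        using True by (simp add: matrix_vector_mult_add_rdistrib scaleR_matrix_vector_assoc)
      moreover have "(C1 *v x0) $ i = x0 \<bullet> x0" for i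
        by (simp add: C1_def matrix_vector_mul_component)
      ultimately show ?thesis using \<epsilon>(1) x0(1) by (auto simp: vec_eq_iff)
    qed
    ultimately show thesis
      by (intro that[of "block11 M0" "block12 M0" "block21 M0 + \<epsilon> *\<^sub>R C1" "block22 M0"]) simp_all
  qed
  obtain V where V: "subspace V" "dim V = CARD('p)" "\<And>v. v \<in> V \<Longrightarrow> v \<noteq> 0 \<Longrightarrow> v \<bullet> (S *v v) < 0"
    using definite_subspace[OF S, of "- 1"] neg by (auto simp: lessThan_def)
  \<comment> \<open>The states \<open>t x0\<close> carry no stored energy and the energy of the
    successor state is nonnegative, so dissipativity makes the supply nonnegative on the range of
    \<open>h\<close>. As \<open>C *v x0 \<noteq> 0\<close>, that range has dimension m + 1.\<close>
  define h :: "real \<times> (real^'m) \<Rightarrow> real^('m + 'p)"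
    where "h e = vjoin (snd e) (fst e *\<^sub>R (C *v x0) + D *v snd e)" for e
  have h: "linear h" unfolding h_def by (intro linear_block_intros)
  have h0: "e = 0" if "h e = 0" for e
    using that Cx unfolding h_def by (auto simp: prod_eq_iff)
  have "h e \<bullet> (S *v h e) \<ge> 0" for e
  proof -
    let ?b = "A *v (fst e *\<^sub>R x0) + B *v snd e"
    have "dissip P S A B C D (fst e *\<^sub>R x0) (snd e) \<ge> 0" using M by (rule diss)
    moreover have "?b \<bullet> (P *v ?b) \<ge> 0" using P by (simp add: psd_def)
    ultimately show ?thesis
      unfolding dissip_def h_def by (simp add: matrix_vector_mult_scaleR x0(2))
  qed
  then have "dim V + dim (range h) \<le> DIM(real^('m + 'p))"
    by (intro dim_nonneg_negative_definite[where f = "(*v) S"] V dim_range_injective(1)[OF h h0]) auto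
  then show False using dim_range_injective(2)[OF h h0] V(2) by simp
qed

section \<open>The block matrices of both inequalities as quadratic forms\<close>

lemma dissipation_mat_form:
  "vjoin (vjoin a s) (vjoin b t) \<bullet> (dissipation_mat S P *v vjoin (vjoin a s) (vjoin b t)) =
    a \<bullet> (P *v a) - b \<bullet> (P *v b) + vjoin s t \<bullet> (S *v vjoin s t)"
proof -
  have "S *v vjoin s t = block_mat (block11 S) (block12 S) (block21 S) (block22 S) *v vjoin s t"
    by (simp add: block_mat_collapse)
  then show ?thesis
    unfolding dissipation_mat_def
    by (simp add: block_mat_vjoin vjoin_add inner_vjoin minus_matrix_vec inner_add_right)
qed

lemma symmetric_minus: "symmetric_mat (- A) \<longleftrightarrow> symmetric_mat A"
  by (auto simp: symmetric_mat_def transpose_def vec_eq_iff)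

lemma symmetric_dissipation_mat:
  assumes "symmetric_mat S" "symmetric_mat P"
  shows "symmetric_mat (dissipation_mat S P)"
  using symmetric_blocks[OF assms(1)] assms(2)
  unfolding dissipation_mat_def symmetric_block_mat transpose_block_mat
  by (simp add: symmetric_minus) (simp add: symmetric_mat_def transpose_zero)

lemma psd_dissipation_iff:
  fixes P :: "real^'n^'n" and S :: "real^('m::finite + 'p::finite)^('m + 'p)"
    and L :: "real^('n::finite + 'm::finite)^(('n + 'm) + ('n + 'p))"
  assumes "symmetric_mat S" "symmetric_mat P"
    and L: "L = vstack (block_mat (mat 1) 0 0 (mat 1)) (block_mat A B C D)"
  shows "psd (transpose L ** dissipation_mat S P ** L) \<longleftrightarrow> (\<forall>x u. dissip P S A B C D x u \<ge> 0)"
proof -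
  have "vjoin x u \<bullet> ((transpose L ** dissipation_mat S P ** L) *v vjoin x u) = dissip P S A B C D x u" for x u
    unfolding transpose_congruence_form L vstack_vec block_mat_vjoin
    by (simp add: dissipation_mat_form dissip_def)
  then have "(\<forall>v. 0 \<le> v \<bullet> ((transpose L ** dissipation_mat S P ** L) *v v)) \<longleftrightarrow>
      (\<forall>x u. dissip P S A B C D x u \<ge> 0)"
    by (metis vjoin_cases)
  then show ?thesis
    using symmetric_congruence[OF symmetric_dissipation_mat[OF assms(1,2)], of L] by (simp add: psd_def)
qed

definition dual_supply_mat where
  "dual_supply_mat R F G H = block_mat (block_mat R 0 0 H) (block_mat 0 0 0 (- transpose G))
      (block_mat 0 0 0 (- G)) (block_mat (- R) 0 0 F)"

text \<open>With \<open>transpose M *v z\<close> split as \<open>(w1, w2)\<close>, the signs of the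
  \<open>G\<close> blocks absorb the passage from \<open>w2\<close> to \<open>- w2\<close>, and the
  blocks of \<open>- T\<close> appear in swapped order because the output part \<open>z2\<close>
  precedes \<open>w2\<close>.\<close>

lemma dual_supply_form:
  fixes T :: "real^('m::finite + 'p::finite)^('m + 'p)" and F :: "real^'m^'m" and G :: "real^'p^'m" and H :: "real^'p^'p"
    and R A :: "real^'n^'n"
  assumes T: "- T = block_mat F G (transpose G) H"
    and M: "M = block_mat A B C D"
  shows "vjoin (vjoin z1 z2) (transpose M *v vjoin z1 z2) \<bullet>
      (dual_supply_mat R F G H *v vjoin (vjoin z1 z2) (transpose M *v vjoin z1 z2)) =
    dual_dissip R T A B C D z1 z2"
proof -
  define w1 where "w1 = transpose A *v z1 + transpose C *v z2"
  define w2 where "w2 = transpose B *v z1 + transpose D *v z2"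
  have w: "transpose M *v vjoin z1 z2 = vjoin w1 w2"
    unfolding M transpose_block_mat block_mat_vjoin w1_def w2_def ..
  have "vjoin (- w2) z2 \<bullet> (T *v vjoin (- w2) z2) = - (vjoin (- w2) z2 \<bullet> (- T *v vjoin (- w2) z2))"
    by (simp add: minus_matrix_vec)
  also have "\<dots> = - (w2 \<bullet> (F *v w2) - 2 * (z2 \<bullet> (transpose G *v w2)) + z2 \<bullet> (H *v z2))"
  proof -
    have "w2 \<bullet> (G *v z2) = z2 \<bullet> (transpose G *v w2)"
      by (metis dot_lmul_matrix inner_commute transpose_matrix_vector)
    then show ?thesis unfolding T block_mat_vjoin inner_vjoin
      by (simp add: matrix_vec_minus inner_simps del: transpose_matrix_vector)
  qed
  finally have "vjoin (- w2) z2 \<bullet> (T *v vjoin (- w2) z2) =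
    - (w2 \<bullet> (F *v w2) - 2 * (z2 \<bullet> (transpose G *v w2)) + z2 \<bullet> (H *v z2))" .
  moreover have "w2 \<bullet> (G *v z2) = z2 \<bullet> (transpose G *v w2)"
    by (metis dot_lmul_matrix inner_commute transpose_matrix_vector)
  ultimately show ?thesis
    unfolding w dual_dissip_def w1_def[symmetric] w2_def[symmetric] dual_supply_mat_def
      block_mat_vjoin vjoin_add inner_vjoin
    by (simp add: minus_matrix_vec inner_simps del: transpose_matrix_vector)
qed

lemma symmetric_dual_supply_mat:
  assumes "symmetric_mat R" "symmetric_mat F" "symmetric_mat H"
  shows "symmetric_mat (dual_supply_mat R F G H)"
  using assms unfolding dual_supply_mat_def symmetric_block_mat transpose_block_mat
  by (simp add: symmetric_minus) (simp add: symmetric_mat_def transpose_zero transpose_minus)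

section \<open>The equivalence of informativity and the matrix inequality\<close>

theorem theorem8:
  fixes u :: "nat \<Rightarrow> real^'m" and x :: "nat \<Rightarrow> real^'n" and y :: "nat \<Rightarrow> real^'p"
    and \<Xi> :: "real^(1 + 't \<times> ('n + 'p))^(1 + 't::{finite, linorder} \<times> ('n + 'p))"
    and \<xi> :: "real^'t::{finite, linorder}^'t::{finite, linorder}"
    and As :: "real^'n^'n" and Bs :: "real^'m^'n" and Cs :: "real^'n^'p" and Ds :: "real^'m^'p"
    and S :: "real^('m + 'p)^('m + 'p)"
    and F :: "real^'m^'m" and G :: "real^'p^'m" and H :: "real^'p^'p"
  assumes "\<Xi> \<in> Pi_set"
    and "symmetric_mat \<xi>"
    and "block22 \<Xi> = kron \<xi> (mat 1)"
    and "(As, Bs, Cs, Ds) \<in> compatible_systems \<Xi> u x y"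
    and "pd (schur (N_mat \<Xi> u x y))"
    and "symmetric_mat S"
    and "eigenvalue_count S {..<0} = CARD('p)"
    and "eigenvalue_count S {0} = 0"
    and "eigenvalue_count S {0<..} = CARD('m)"
    and "symmetric_mat F" and "symmetric_mat H"
    and "- matrix_inv S = block_mat F G (transpose G) H"
  shows "informative_dissipativity \<Xi> u x y S \<longleftrightarrow>
    (\<exists>(R :: real^'n^'n) (\<alpha> :: real). pd R \<and> \<alpha> \<ge> 0 \<and>
       psd (block_mat (block_mat R 0 0 H) (block_mat 0 0 0 (- transpose G))
                      (block_mat 0 0 0 (- G)) (block_mat (- R) 0 0 F)
            - \<alpha> *\<^sub>R Q_mat \<Xi> \<xi> u x y))"
proof -
  let ?\<Sigma> = "compatible_systems \<Xi> u x y" and ?T = "matrix_inv S"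
  define c where "c = schur (N_mat \<Xi> u x y) $ 1 $ 1"
  \<comment> \<open>Testing the one-by-one Schur complement on its unit vector extracts the positive
    scalar \<open>c\<close>.\<close>
  have "(axis 1 1 :: real^1) \<bullet> (schur (N_mat \<Xi> u x y) *v axis 1 1) > 0"
    using assms(5) by (simp add: pd_def axis_eq_0_iff)
  then have c: "c > 0" by (simp add: c_def inner_axis' matrix_vector_mult_basis column_def)
  obtain Q :: "real^('n + 'm)^('n + 'm)" and M0 :: "real^('n + 'm)^('n + 'p)"
    where Q: "symmetric_mat Q" "\<And>v. v \<bullet> (Q *v v) \<le> 0" and sQ: "symmetric_mat (Q_mat \<Xi> \<xi> u x y)"
    and compat: "\<And>A B C D. (A, B, C, D) \<in> ?\<Sigma> \<longleftrightarrow>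
       c + (block_mat A B C D - M0) \<bullet> ((block_mat A B C D - M0) ** Q) \<ge> 0"
    and Q_form: "\<And>z w. vjoin z w \<bullet> (Q_mat \<Xi> \<xi> u x y *v vjoin z w) =
       c * (z \<bullet> z) + (w - transpose M0 *v z) \<bullet> (Q *v (w - transpose M0 *v z))"
    using data_ellipsoid[OF assms(1-3), of u x y] unfolding c_def by blast
  have S: "invertible S" using assms(6,8) by (rule invertible_if_eigenvalue_count_0)
  have T: "symmetric_mat ?T" using assms(6) S by (rule symmetric_matrix_inv)
  have inf: "informative_dissipativity \<Xi> u x y S \<longleftrightarrow>
      (\<exists>P. psd P \<and> (\<forall>A B C D. (A, B, C, D) \<in> ?\<Sigma> \<longrightarrow> (\<forall>x u. dissip P S A B C D x u \<ge> 0)))"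
    unfolding informative_dissipativity_def Let_def
    by (intro ex_cong1 conj_cong refl)
      (auto simp: psd_dissipation_iff[OF assms(6) conjunct1[OF psd_def[THEN iffD1]] refl])
  \<comment> \<open>Stated for any pair of mutually inverse matrices, since one direction starts
    from \<open>P\<close> and the other from \<open>R\<close>.\<close>
  have dual: "(\<forall>A B C D. (A, B, C, D) \<in> ?\<Sigma> \<longrightarrow> (\<forall>x u. dissip P S A B C D x u \<ge> 0)) \<longleftrightarrow>
      (\<exists>\<alpha>\<ge>0. psd (dual_supply_mat R F G H - \<alpha> *\<^sub>R Q_mat \<Xi> \<xi> u x y))"
    if P: "pd P" and R: "pd R" and PR: "P ** R = mat 1" "R ** P = mat 1" for P R :: "real^'n^'n"
  proof -
    let ?D = "dual_supply_mat R F G H" and ?Q = "Q_mat \<Xi> \<xi> u x y"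
    have sD: "symmetric_mat ?D"
      using R assms(10,11) by (intro symmetric_dual_supply_mat) (auto simp: pd_def)
    have psd: "psd (?D - \<alpha> *\<^sub>R ?Q) \<longleftrightarrow> (\<forall>v. v \<bullet> (?D *v v) \<ge> \<alpha> * (v \<bullet> (?Q *v v)))" for \<alpha>
    proof -
      have "symmetric_mat (?D - \<alpha> *\<^sub>R ?Q)" using sD sQ
        by (simp add: symmetric_mat_def transpose_def vec_eq_iff)
      then show ?thesis
        by (simp add: psd_def matrix_vector_mult_diff_rdistrib inner_diff_right
            scaleR_matrix_vector_assoc[symmetric])
    qed
    have pt: "(\<forall>x u. dissip P S A B C D x u \<ge> 0) \<longleftrightarrow>
        (\<forall>z. vjoin z (transpose M *v z) \<bullet> (?D *v vjoin z (transpose M *v z)) \<ge> 0)"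
      if M: "M = block_mat A B C D" for A B C D M
      unfolding dissipation_duality[OF P R PR assms(6) T matrix_inv_inverse[OF S] assms(7,9)]
        dual_supply_form[OF assms(12) M, symmetric]
      by (metis vjoin_cases)
    have "(\<forall>A B C D. (A, B, C, D) \<in> ?\<Sigma> \<longrightarrow> (\<forall>x u. dissip P S A B C D x u \<ge> 0)) \<longleftrightarrow>
       (\<forall>M. c + (M - M0) \<bullet> ((M - M0) ** Q) \<ge> 0 \<longrightarrow>
          (\<forall>z. vjoin z (transpose M *v z) \<bullet> (?D *v vjoin z (transpose M *v z)) \<ge> 0))"
      unfolding compat pt[OF refl] by (metis block_mat_collapse)
    then show ?thesis
      unfolding psd matrix_s_lemma[OF Q c sD sQ Q_form] .
  qed
  show ?thesis
    unfolding dual_supply_mat_def[symmetric]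
  proof
    assume "informative_dissipativity \<Xi> u x y S"
    then obtain P where "psd P"
      and diss: "\<forall>A B C D. (A, B, C, D) \<in> ?\<Sigma> \<longrightarrow> (\<forall>x u. dissip P S A B C D x u \<ge> 0)"
      unfolding inf by blast
    \<comment> \<open>Informativity only provides a semidefinite \<open>P\<close>; definiteness is
      what permits \<open>R = matrix_inv P\<close>.\<close>
    have P: "pd P"
      using \<open>psd P\<close> assms(6,7) c by (rule storage_positive_definite) (use diss compat in blast)
    note inv = pd_matrix_inv[OF P] matrix_inv_inverse[OF pd_invertible[OF P]]
    from dual[OF P inv] diss inv(1)
    show "\<exists>R \<alpha>. pd R \<and> 0 \<le> \<alpha> \<and> psd (dual_supply_mat R F G H - \<alpha> *\<^sub>R Q_mat \<Xi> \<xi> u x y)" by blast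
  next
    assume "\<exists>R \<alpha>. pd R \<and> 0 \<le> \<alpha> \<and> psd (dual_supply_mat R F G H - \<alpha> *\<^sub>R Q_mat \<Xi> \<xi> u x y)"
    then obtain R \<alpha> where R: "pd R" "0 \<le> \<alpha>"
      "psd (dual_supply_mat R F G H - \<alpha> *\<^sub>R Q_mat \<Xi> \<xi> u x y)" by blast
    note inv = pd_matrix_inv[OF R(1)] matrix_inv_inverse[OF pd_invertible[OF R(1)]]
    have "psd (matrix_inv R)" using inv(1) unfolding psd_def pd_def by (metis inner_zero_left less_imp_le order_refl)
    then show "informative_dissipativity \<Xi> u x y S"
      unfolding inf using dual[OF inv(1) R(1) inv(3,2)] R by blast
  qed
qed

end
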